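(* In the single-target binary-tree search problem described in the context, let $f_l$ and $g_l$ be Bernoulli distributions with parameters (success probabilities) $\mu_l$ and $1-\mu_l$, respectively. Assume that $\mu_l=\frac12-\left(\frac12-\mu_0\right)(l+1)^{-\alpha}$ for $l=0,1,2,\ldots,\log_2 M$, for some $\alpha\in\mathbb Z^+$ and $0<\mu_0<\frac12$. Then the Bayes risk of the IRW policy $\Gamma_{\mathrm{IRW}}$ is upper bounded by $$R(\Gamma_{\mathrm{IRW}})\le O\big(c(\log_2 M)^{2\alpha+1}\big)+\frac{c\log\frac{\log_2 M}{c}}{D(g_0\|f_0)}+O(c),$$ where the constants in the $O(\cdot)$ terms are independent of $c$ and $M$.
   Context: **Model.** There are $M=2^k$ processes ($k\ge1$), identified with the leaves of a complete binary tree; leaves are at level $0$ and the root at level $\log_2 M$. Exactly one leaf is the target (anomalous). Hypothesis $H_m$ ($m=1,\ldots,M$), with prior probability $\pi_m$, is that leaf $m$ is the target. At each time a node of the tree is probed, giving one observation, independent of the past given the probed node: a level-$l$ node yields an observation with distribution $g_l$ if its subtree contains the target, and $f_l$ otherwise. The distributions $g_l,f_l$ are known to the decision maker. $D(\cdot\|\cdot)$ is Kullback-Leibler divergence. $\log$ is the natural logarithm. **Strategies and risk.** A strategy $\Gamma=(\{\phi(t)\}_{t\ge1},\tau,\delta)$ consists of selection rules $\phi(t)$ (which node to probe at time $t$, based on past actions and observations), a stopping rule $\tau$ (total number of observations taken), and a declaration rule $\delta\in\{1,\ldots,M\}$ at stopping. Put $P_e(\Gamma)=\sum_m\pi_m\mathbb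 P_\Gamma[\delta\ne m\mid H_m]$, $Q(\Gamma)=\sum_m\pi_m\mathbb E_\Gamma[\tau\mid H_m]$, and, for sampling cost $c\in(0,1)$, the Bayes risk $R(\Gamma)=P_e(\Gamma)+cQ(\Gamma)$. **IRW policy (information-directed random walk).** Fix a confidence level $p\in(1/2,1)$. The policy performs a random walk on the nodes, starting at the root (the parent of the root is defined to be the root itself). - At a node of level $l>0$: take $K_l$ fresh samples from each of its two children, and compute for each child the sum log-likelihood ratio (SLLR) $\sum_{n=1}^{K_l}\log\frac{g_{l-1}(y(n))}{f_{l-1}(y(n))}$ of its samples. If both SLLRs are negative, move to the parent; otherwise move to the child with the larger SLLR. The sample sizes $K_l$ are design parameters, computed offline from $g_{l-1},f_{l-1}$, chosen suitably so as to ensure $p_l^{(g)}>p$ and $p_l^{(f)}>p$, where, with $Y_n$ i.i.d. $\sim g_{l-1}$ and $Z_n$ i.i.d. $\sim f_{l-1}$ (independent of each other), $$p_l^{(g)}=\Pr\Big[\sum_{n=1}^{K_l}\log\tfrac{g_{l-1}(Y_n)}{f_{l-1}(Y_n)}>\max\Big\{\sum_{n=1}^{K_l}\log\tfrac{g_{l-1}(Z_n)}{f_{l-1}(Z_n)},0\Big\}\Big],\quad p_l^{(f)}=\Big[\Pr\Big(\sum_{n=1}^{K_l}\log\tfrac{g_{l-1}(Z_n)}{f_{l-1}(Z_n)}<0\Big)\Big]^2 .$$ - At a leaf $m$: take samples one at a time from leaf $m$ and update $S_m(t)=\sum_{n=1}^t\log\frac{g_0(y(n))}{f_0(y(n))}$,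 using only samples taken during the current visit. When $S_m(t)$ drops below $0$, move to the parent of $m$. When $S_m(t)$ exceeds $\log\frac{\log_2 M}{c}$, stop and declare $m$ the target. *)

theory Defs
  imports "HOL-Probability.Probability"
begin

text \<open>
  Nodes are pairs (level, index). In the tree of depth k (with M = 2 ^ k leaves) level l holds the
  indices i < 2 ^ (k - l); the children of (l, i) are (l - 1, 2 i) and (l - 1, 2 i + 1), the root
  is (k, 0), and leaf m is (0, m). Leaves, hence hypotheses, are numbered from 0.
  Throughout, k = log 2 M.
\<close>

type_synonym node = "nat \<times> nat"

definition tree_nodes :: "nat \<Rightarrow> node set" where
  "tree_nodes k = {(l, i). l \<le> k \<and> i < 2 ^ (k - l)}"

definition parent :: "nat \<Rightarrow> node \<Rightarrow> node" where
  "parent k = (\<lambda>(l, i). if l < k then (l + 1, i div 2) else (l, i))"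

definition subtree_contains :: "node \<Rightarrow> nat \<Rightarrow> bool" where
  "subtree_contains = (\<lambda>(l, i) m. m div 2 ^ l = i)"

definition obs_law :: "(nat \<Rightarrow> 'o pmf) \<Rightarrow> (nat \<Rightarrow> 'o pmf) \<Rightarrow> nat \<Rightarrow> node \<Rightarrow> 'o pmf" where
  "obs_law f g m v = (if subtree_contains v m then g (fst v) else f (fst v))"

text \<open>
  The law under hypothesis m: entry t of a sample stream assigns to every node of the tree the
  observation that probing it as the (t+1)-st probe would yield. Entries are i.i.d. in t, so the
  observation obtained from the probed node is independent of the past. Observation types are
  countable wherever probabilities are taken, so that all events below are measurable.
\<close>

definition hyp_measure ::
  "nat \<Rightarrow> (nat \<Rightarrow> 'o pmf) \<Rightarrow> (nat \<Rightarrow> 'o pmf) \<Rightarrow> nat \<Rightarrow> (node \<Rightarrow> 'o) stream measure" where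
  "hyp_measure k f g m =
     stream_space (measure_pmf (Pi_pmf (tree_nodes k) undefined (obs_law f g m)))"

text \<open>Histories list the past probes and observations in chronological order.\<close>

type_synonym 'o history = "(node \<times> 'o) list"

record 'o strategy =
  select :: "'o history \<Rightarrow> node"
  halt :: "'o history \<Rightarrow> bool"
  decide :: "'o history \<Rightarrow> nat"

primrec hist :: "'o strategy \<Rightarrow> (node \<Rightarrow> 'o) stream \<Rightarrow> nat \<Rightarrow> 'o history" where
  "hist \<Gamma> \<omega> 0 = []"
| "hist \<Gamma> \<omega> (Suc t) =
     (let h = hist \<Gamma> \<omega> t; v = select \<Gamma> h in h @ [(v, (\<omega> !! t) v)])"

definition stop_time :: "'o strategy \<Rightarrow> (node \<Rightarrow> 'o) stream \<Rightarrow> enat" where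
  "stop_time \<Gamma> \<omega> = Inf {enat t | t. halt \<Gamma> (hist \<Gamma> \<omega> t)}"

text \<open>Runs that never stop count as errors (their mean sample size is infinite anyway).\<close>

definition declares :: "'o strategy \<Rightarrow> nat \<Rightarrow> (node \<Rightarrow> 'o) stream \<Rightarrow> bool" where
  "declares \<Gamma> m \<omega> \<longleftrightarrow> (\<exists>t. stop_time \<Gamma> \<omega> = enat t \<and> decide \<Gamma> (hist \<Gamma> \<omega> t) = m)"

definition error_prob ::
  "nat \<Rightarrow> (nat \<Rightarrow> 'o::countable pmf) \<Rightarrow> (nat \<Rightarrow> 'o pmf) \<Rightarrow> (nat \<Rightarrow> real) \<Rightarrow> 'o strategy \<Rightarrow> ennreal" where
  "error_prob k f g \<pi> \<Gamma> =
     (\<Sum>m<2 ^ k. ennreal (\<pi> m) *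
        emeasure (hyp_measure k f g m) {\<omega> \<in> space (hyp_measure k f g m). \<not> declares \<Gamma> m \<omega>})"

definition mean_samples ::
  "nat \<Rightarrow> (nat \<Rightarrow> 'o::countable pmf) \<Rightarrow> (nat \<Rightarrow> 'o pmf) \<Rightarrow> (nat \<Rightarrow> real) \<Rightarrow> 'o strategy \<Rightarrow> ennreal" where
  "mean_samples k f g \<pi> \<Gamma> =
     (\<Sum>m<2 ^ k. ennreal (\<pi> m) * (\<integral>\<^sup>+ \<omega>. ennreal_of_enat (stop_time \<Gamma> \<omega>) \<partial>hyp_measure k f g m))"

definition bayes_risk ::
  "nat \<Rightarrow> (nat \<Rightarrow> 'o::countable pmf) \<Rightarrow> (nat \<Rightarrow> 'o pmf) \<Rightarrow> (nat \<Rightarrow> real) \<Rightarrow> real \<Rightarrow> 'o strategy \<Rightarrow> ennreal" where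
  "bayes_risk k f g \<pi> c \<Gamma> = error_prob k f g \<pi> \<Gamma> + ennreal c * mean_samples k f g \<pi> \<Gamma>"

definition is_prior :: "nat \<Rightarrow> (nat \<Rightarrow> real) \<Rightarrow> bool" where
  "is_prior k \<pi> \<longleftrightarrow> (\<forall>m<2 ^ k. 0 \<le> \<pi> m) \<and> (\<Sum>m<2 ^ k. \<pi> m) = 1"

definition sllr :: "(nat \<Rightarrow> 'o pmf) \<Rightarrow> (nat \<Rightarrow> 'o pmf) \<Rightarrow> nat \<Rightarrow> 'o list \<Rightarrow> real" where
  "sllr f g l ys = (\<Sum>y\<leftarrow>ys. ln (pmf (g l) y / pmf (f l) y))"

definition p_g :: "(nat \<Rightarrow> 'o pmf) \<Rightarrow> (nat \<Rightarrow> 'o pmf) \<Rightarrow> nat \<Rightarrow> nat \<Rightarrow> real" where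
  "p_g f g l n =
     measure_pmf.prob (pair_pmf (replicate_pmf n (g (l - 1))) (replicate_pmf n (f (l - 1))))
       {(ys, zs). sllr f g (l - 1) ys > max (sllr f g (l - 1) zs) 0}"

definition p_f :: "(nat \<Rightarrow> 'o pmf) \<Rightarrow> (nat \<Rightarrow> 'o pmf) \<Rightarrow> nat \<Rightarrow> nat \<Rightarrow> real" where
  "p_f f g l n =
     (measure_pmf.prob (replicate_pmf n (f (l - 1))) {zs. sllr f g (l - 1) zs < 0})\<^sup>2"

definition adequate_size ::
  "real \<Rightarrow> (nat \<Rightarrow> 'o pmf) \<Rightarrow> (nat \<Rightarrow> 'o pmf) \<Rightarrow> nat \<Rightarrow> nat \<Rightarrow> bool" where
  "adequate_size p f g l n \<longleftrightarrow> p_g f g l n > p \<and> p_f f g l n > p"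

text \<open>
  Adequacy alone puts no upper bound on the sample sizes, so no risk bound can hold for every
  adequate choice. A suitable choice is one that is adequate and within a constant factor of the
  least adequate size.
\<close>

definition least_size :: "real \<Rightarrow> (nat \<Rightarrow> 'o pmf) \<Rightarrow> (nat \<Rightarrow> 'o pmf) \<Rightarrow> nat \<Rightarrow> nat" where
  "least_size p f g l = (LEAST n. adequate_size p f g l n)"

text \<open>
  State of the random walk: \<open>At v ys\<close> means that the walk is at v and ys lists the observations
  collected during the current visit. At an internal node of level l the first K l of them come
  from the left child and the next K l from the right child; at a leaf all come from that leaf.
\<close>

datatype 'o walk_state = At node "'o list" | Declared nat

fun irw_probe :: "(nat \<Rightarrow> nat) \<Rightarrow> 'o walk_state \<Rightarrow> node" where
  "irw_probe K (At (l, i) ys) =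
     (if l = 0 then (0, i)
      else if length ys < K l then (l - 1, 2 * i) else (l - 1, 2 * i + 1))"
| "irw_probe K (Declared m) = (0, m)"

text \<open>
  The argument tie settles the choice between children with equal nonnegative SLLRs
  (true means left); it may depend on the node and on the samples of the current visit.
\<close>

fun irw_step ::
  "nat \<Rightarrow> (nat \<Rightarrow> 'o pmf) \<Rightarrow> (nat \<Rightarrow> 'o pmf) \<Rightarrow> (nat \<Rightarrow> nat) \<Rightarrow> (node \<Rightarrow> 'o list \<Rightarrow> bool) \<Rightarrow> real
   \<Rightarrow> 'o walk_state \<Rightarrow> 'o \<Rightarrow> 'o walk_state" where
  "irw_step k f g K tie c (At (l, i) xs) y =
     (let ys = xs @ [y] in
      if l = 0 then
        (let S = sllr f g 0 ys in
         if S > ln (real k / c) then Declared i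
         else if S < 0 then At (parent k (0, i)) []
         else At (0, i) ys)
      else if length ys < 2 * K l then At (l, i) ys
      else
        (let a = sllr f g (l - 1) (take (K l) ys);
             b = sllr f g (l - 1) (drop (K l) ys)
         in if a < 0 \<and> b < 0 then At (parent k (l, i)) []
            else if a > b \<or> (a = b \<and> tie (l, i) ys) then At (l - 1, 2 * i) []
            else At (l - 1, 2 * i + 1) []))"
| "irw_step k f g K tie c (Declared m) y = Declared m"

definition irw_state ::
  "nat \<Rightarrow> (nat \<Rightarrow> 'o pmf) \<Rightarrow> (nat \<Rightarrow> 'o pmf) \<Rightarrow> (nat \<Rightarrow> nat) \<Rightarrow> (node \<Rightarrow> 'o list \<Rightarrow> bool) \<Rightarrow> real
   \<Rightarrow> 'o history \<Rightarrow> 'o walk_state" where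
  "irw_state k f g K tie c h = foldl (irw_step k f g K tie c) (At (k, 0) []) (map snd h)"

definition irw ::
  "nat \<Rightarrow> (nat \<Rightarrow> 'o pmf) \<Rightarrow> (nat \<Rightarrow> 'o pmf) \<Rightarrow> (nat \<Rightarrow> nat) \<Rightarrow> (node \<Rightarrow> 'o list \<Rightarrow> bool) \<Rightarrow> real
   \<Rightarrow> 'o strategy" where
  "irw k f g K tie c =
     \<lparr>select = (\<lambda>h. irw_probe K (irw_state k f g K tie c h)),
      halt = (\<lambda>h. \<exists>m. irw_state k f g K tie c h = Declared m),
      decide = (\<lambda>h. case irw_state k f g K tie c h of Declared m \<Rightarrow> m | At v ys \<Rightarrow> 0)\<rparr>"

text \<open>The library's divergence takes the reference measure first: this is D(q || r), in nats.\<close>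

definition KL_pmf :: "'o pmf \<Rightarrow> 'o pmf \<Rightarrow> real" where
  "KL_pmf q r = KL_divergence (exp 1) (measure_pmf r) (measure_pmf q)"

end

theory Submission
  imports Defs
begin

text \<open>
  The risk under each hypothesis is bounded by an explicit supersolution of the walk: a function of
  the state that covers the sampling cost c plus its own mean at the next state, and is at least 1 at
  a wrong declaration. At the start of a visit to a node it is affine in the tree distance d to the
  target, with slope of order \<open>c * k ^ (2 * \<alpha>)\<close>: adequacy makes d drift down at rate at
  least \<open>2 * p - 1\<close> per visit, and by Hoeffding's inequality a visit costs
  \<open>O(k ^ (2 * \<alpha>))\<close> samples. Inside the leaves the supersolution is the gambler's ruin
  solution; the expected length of the final climb gives the leading term
  \<open>c * ln (k / c) / D\<close>, since the SLLR at the target has drift D per sample.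
\<close>

subsection \<open>Measurability of stopping data\<close>

text \<open>A direct analysis would have to separate the final stay at the target from all earlier
  excursions and to add up errors over a random number of visits to wrong leaves. Charging errors
  and samples to one potential avoids both: a one-step inequality needs no prior knowledge that the
  walk stops. The difficulty is self-consistency, since the walk can leave the target leaf again.
  The climb from 0 falls to \<open>- llr\<close> with probability at most
  \<open>q / (1 - q)\<close>, and the walk is then at distance 1; so the cost \<open>x\<close> of
  such returns should satisfy \<open>x = q / (1 - q) * (c * a + x)\<close>. The solution
  \<open>c * a * q / (1 - 2 * q)\<close> is the second summand of \<open>base\<close>. A wrong leaf
  is declared with probability at most \<open>c / k\<close> per visit, because the likelihood ratio
  is a martingale there and the threshold for it is \<open>k / c\<close>; the slope absorbs this
  charge. The exponent arises because the children of a level-l node have bias proportional to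
  \<open>1 / l ^ \<alpha>\<close>, and Hoeffding's bound needs samples of the order of the inverse
  square; the distance k of the root from every leaf supplies the last factor.\<close>

lemma measurable_snth_apply:
  fixes P :: "(node \<Rightarrow> 'o) pmf"
  shows "(\<lambda>\<omega>. (\<omega> !! t) v) \<in> stream_space (measure_pmf P) \<rightarrow>\<^sub>M count_space UNIV"
  by (rule measurable_compose[OF measurable_snth]) simp

text \<open>The probed node depends on the past, but there are only countably many histories, so
  measurability can be checked with the history held fixed.\<close>

lemma measurable_hist:
  fixes \<Gamma> :: "'o::countable strategy" and P :: "(node \<Rightarrow> 'o) pmf"
  shows "(\<lambda>\<omega>. hist \<Gamma> \<omega> t) \<in> stream_space (measure_pmf P) \<rightarrow>\<^sub>M count_space UNIV"
proof (induction t)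
  case 0
  show ?case by simp
next
  case (Suc t)
  have "(\<lambda>\<omega>. h @ [(select \<Gamma> h, (\<omega> !! t) (select \<Gamma> h))])
      \<in> stream_space (measure_pmf P) \<rightarrow>\<^sub>M count_space UNIV" for h
    by (rule measurable_compose[OF measurable_snth_apply]) simp
  from measurable_compose_countable[OF this Suc.IH] show ?case
    by (simp add: Let_def)
qed

lemma stop_time_eq_enat_iff:
  "stop_time \<Gamma> \<omega> = enat t \<longleftrightarrow>
    halt \<Gamma> (hist \<Gamma> \<omega> t) \<and> (\<forall>s<t. \<not> halt \<Gamma> (hist \<Gamma> \<omega> s))"
proof -
  let ?A = "{enat t | t. halt \<Gamma> (hist \<Gamma> \<omega> t)}"
  show ?thesis
  proof
    assume eq: "stop_time \<Gamma> \<omega> = enat t"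
    have ne: "?A \<noteq> {}"
      using eq by (auto simp: stop_time_def Inf_enat_def split: if_splits)
    from wellorder_InfI[of _ ?A] ne have "Inf ?A \<in> ?A"
      by blast
    moreover have "\<not> halt \<Gamma> (hist \<Gamma> \<omega> s)" if "s < t" for s
    proof
      assume "halt \<Gamma> (hist \<Gamma> \<omega> s)"
      then have "Inf ?A \<le> enat s" by (intro Inf_lower) auto
      with eq that show False by (simp add: stop_time_def)
    qed
    ultimately show "halt \<Gamma> (hist \<Gamma> \<omega> t) \<and> (\<forall>s<t. \<not> halt \<Gamma> (hist \<Gamma> \<omega> s))"
      using eq by (auto simp: stop_time_def)
  next
    assume "halt \<Gamma> (hist \<Gamma> \<omega> t) \<and> (\<forall>s<t. \<not> halt \<Gamma> (hist \<Gamma> \<omega> s))"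
    then show "stop_time \<Gamma> \<omega> = enat t"
      unfolding stop_time_def
      by (intro antisym Inf_lower Inf_greatest) (auto simp: not_less[symmetric])
  qed
qed

lemma stop_time_eq_infinity_iff:
  "stop_time \<Gamma> \<omega> = \<infinity> \<longleftrightarrow> (\<forall>t. \<not> halt \<Gamma> (hist \<Gamma> \<omega> t))"
proof
  assume "stop_time \<Gamma> \<omega> = \<infinity>"
  then have "\<infinity> \<le> enat t" if "halt \<Gamma> (hist \<Gamma> \<omega> t)" for t
    unfolding stop_time_def using that by (metis (mono_tags, lifting) Inf_lower mem_Collect_eq)
  then show "\<forall>t. \<not> halt \<Gamma> (hist \<Gamma> \<omega> t)" by auto
next
  assume "\<forall>t. \<not> halt \<Gamma> (hist \<Gamma> \<omega> t)"
  then have "{enat t | t. halt \<Gamma> (hist \<Gamma> \<omega> t)} = {}"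
    by auto
  then show "stop_time \<Gamma> \<omega> = \<infinity>"
    by (simp add: stop_time_def top_enat_def)
qed

lemma pred_of_hist:
  fixes \<Gamma> :: "'o::countable strategy" and P :: "(node \<Rightarrow> 'o) pmf"
  shows "Measurable.pred (stream_space (measure_pmf P)) (\<lambda>\<omega>. Q (hist \<Gamma> \<omega> t))"
  by (rule measurable_compose[OF measurable_hist]) simp

lemma measurable_stop_time:
  fixes \<Gamma> :: "'o::countable strategy" and P :: "(node \<Rightarrow> 'o) pmf"
  shows "stop_time \<Gamma> \<in> stream_space (measure_pmf P) \<rightarrow>\<^sub>M count_space UNIV"
proof -
  have "Measurable.pred (stream_space (measure_pmf P)) (\<lambda>\<omega>. stop_time \<Gamma> \<omega> = n)" for n
    using pred_of_hist[measurable]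
    by (cases n) (simp_all add: stop_time_eq_enat_iff stop_time_eq_infinity_iff)
  then have "stop_time \<Gamma> -` {n} \<inter> space (stream_space (measure_pmf P))
      \<in> sets (stream_space (measure_pmf P))" for n
    by (simp add: pred_def vimage_def Int_def conj_commute)
  then show ?thesis
    by (simp add: measurable_count_space_eq_countable)
qed

lemma pred_declares:
  fixes \<Gamma> :: "'o::countable strategy" and P :: "(node \<Rightarrow> 'o) pmf"
  shows "Measurable.pred (stream_space (measure_pmf P)) (declares \<Gamma> m)"
  using pred_of_hist[measurable]
  unfolding declares_def stop_time_eq_enat_iff by measurable

text \<open>Error and sampling cost are merged into one nonnegative integrand, so that a single
  potential can bound both.\<close>

lemma bayes_risk_eq:
  fixes f g :: "nat \<Rightarrow> 'o::countable pmf"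
  shows "bayes_risk k f g \<pi> c \<Gamma> = (\<Sum>m<2 ^ k. ennreal (\<pi> m) *
    (\<integral>\<^sup>+ \<omega>. (of_bool (\<not> declares \<Gamma> m \<omega>) + ennreal c * ennreal_of_enat (stop_time \<Gamma> \<omega>))
      \<partial>hyp_measure k f g m))"
proof -
  have eq: "emeasure (hyp_measure k f g m) {\<omega> \<in> space (hyp_measure k f g m). \<not> declares \<Gamma> m \<omega>}
      + ennreal c * (\<integral>\<^sup>+ \<omega>. ennreal_of_enat (stop_time \<Gamma> \<omega>) \<partial>hyp_measure k f g m)
    = (\<integral>\<^sup>+ \<omega>. (of_bool (\<not> declares \<Gamma> m \<omega>) + ennreal c * ennreal_of_enat (stop_time \<Gamma> \<omega>))
      \<partial>hyp_measure k f g m)" for m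
  proof -
    let ?M = "hyp_measure k f g m"
    have [measurable]: "declares \<Gamma> m \<in> ?M \<rightarrow>\<^sub>M count_space UNIV"
      "stop_time \<Gamma> \<in> ?M \<rightarrow>\<^sub>M count_space UNIV"
      unfolding hyp_measure_def by (rule pred_declares measurable_stop_time)+
    have [measurable]: "(\<lambda>\<omega>. ennreal_of_enat (stop_time \<Gamma> \<omega>)) \<in> borel_measurable ?M"
      by (rule measurable_compose[of "stop_time \<Gamma>" _ "count_space UNIV"]) simp_all
    have "emeasure ?M {\<omega> \<in> space ?M. \<not> declares \<Gamma> m \<omega>}
      = (\<integral>\<^sup>+ \<omega>. indicator {\<omega> \<in> space ?M. \<not> declares \<Gamma> m \<omega>} \<omega> \<partial>?M)"
      by (rule nn_integral_indicator[symmetric]) measurable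
    also have "\<dots> = (\<integral>\<^sup>+ \<omega>. of_bool (\<not> declares \<Gamma> m \<omega>) \<partial>?M)"
      by (rule nn_integral_cong) (simp add: indicator_def)
    finally show ?thesis
      by (simp add: nn_integral_add nn_integral_cmult)
  qed
  show ?thesis
    by (simp add: bayes_risk_def error_prob_def mean_samples_def sum_distrib_left
        mult.left_commute[of "ennreal c"] distrib_left sum.distrib flip: eq)
qed

subsection \<open>Supersolutions bound the loss of a controlled observation process\<close>

text \<open>The recursion consumes the head of the stream, which suits first-step analysis;
  \<open>hist\<close> grows at the other end, and \<open>trajectory_Suc_snth\<close> reconciles the
  two.\<close>

primrec trajectory ::
  "('s \<Rightarrow> 'o \<Rightarrow> 's) \<Rightarrow> ('s \<Rightarrow> node) \<Rightarrow> 's \<Rightarrow> (node \<Rightarrow> 'o) stream \<Rightarrow> nat \<Rightarrow> 's" where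
  "trajectory st pr s \<omega> 0 = s"
| "trajectory st pr s \<omega> (Suc t) = trajectory st pr (st s (shd \<omega> (pr s))) (stl \<omega>) t"

lemma trajectory_Suc_snth:
  "trajectory st pr s \<omega> (Suc t) =
    st (trajectory st pr s \<omega> t) ((\<omega> !! t) (pr (trajectory st pr s \<omega> t)))"
  by (induction t arbitrary: s \<omega>) auto

text \<open>A run cut off by the horizon pays no terminal loss, which makes the truncated loss
  increase with the horizon.\<close>

primrec loss_upto ::
  "('s \<Rightarrow> 'o \<Rightarrow> 's) \<Rightarrow> ('s \<Rightarrow> node) \<Rightarrow> ('s \<Rightarrow> ennreal option) \<Rightarrow> ennreal \<Rightarrow> nat \<Rightarrow> 's
    \<Rightarrow> (node \<Rightarrow> 'o) stream \<Rightarrow> ennreal" where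
  "loss_upto st pr fin c 0 s \<omega> = (case fin s of None \<Rightarrow> 0 | Some x \<Rightarrow> x)"
| "loss_upto st pr fin c (Suc t) s \<omega> =
    (case fin s of
      None \<Rightarrow> c + loss_upto st pr fin c t (st s (shd \<omega> (pr s))) (stl \<omega>)
    | Some x \<Rightarrow> x)"

lemma loss_upto_mono: "loss_upto st pr fin c t s \<omega> \<le> loss_upto st pr fin c (Suc t) s \<omega>"
  by (induction t arbitrary: s \<omega>) (auto split: option.splits)

lemma loss_upto_eq:
  assumes "\<And>j. j < t \<Longrightarrow> fin (trajectory st pr s \<omega> j) = None"
  shows "loss_upto st pr fin c t s \<omega> = c * of_nat t +
    (case fin (trajectory st pr s \<omega> t) of None \<Rightarrow> 0 | Some x \<Rightarrow> x)"
  using assms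
proof (induction t arbitrary: s \<omega>)
  case 0
  then show ?case by simp
next
  case (Suc t)
  have "fin (trajectory st pr (st s (shd \<omega> (pr s))) (stl \<omega>) j) = None" if "j < t" for j
    using Suc.prems[of "Suc j"] that by simp
  from Suc.IH[OF this] Suc.prems[of 0] show ?case
    by (simp add: algebra_simps)
qed

lemma measurable_loss_upto:
  fixes P :: "(node \<Rightarrow> 'o::countable) pmf"
  shows "loss_upto st pr fin c t s \<in> borel_measurable (stream_space (measure_pmf P))"
proof (induction t arbitrary: s)
  case 0
  show ?case by simp
next
  case (Suc t)
  have "(\<lambda>\<omega>. loss_upto st pr fin c t (st s y) (stl \<omega>))
      \<in> borel_measurable (stream_space (measure_pmf P))" for y
    by (rule measurable_compose[OF measurable_stl Suc.IH])
  from measurable_compose_countable[OF this measurable_snth_apply[where t = 0 and v = "pr s"]]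
  have "(\<lambda>\<omega>. loss_upto st pr fin c t (st s (shd \<omega> (pr s))) (stl \<omega>))
      \<in> borel_measurable (stream_space (measure_pmf P))"
    by simp
  then show ?case
    by (cases "fin s") simp_all
qed

text \<open>First-step analysis by induction on the horizon: the head of the stream is integrated
  separately from its tail, and only the probed coordinate of the head matters. Its marginal is
  \<open>P (pr s)\<close> because the probed node lies in \<open>A\<close>; outside \<open>A\<close>
  it would be the default \<open>d\<close>.\<close>

lemma nn_integral_loss_upto_le:
  fixes P :: "node \<Rightarrow> 'o::countable pmf"
  assumes fin_A: "finite A"
    and final: "\<And>s x. s \<in> I \<Longrightarrow> fin s = Some x \<Longrightarrow> x \<le> V s"
    and probe: "\<And>s. s \<in> I \<Longrightarrow> fin s = None \<Longrightarrow> pr s \<in> A"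
    and step: "\<And>s y. s \<in> I \<Longrightarrow> fin s = None \<Longrightarrow> st s y \<in> I"
    and super: "\<And>s. s \<in> I \<Longrightarrow> fin s = None \<Longrightarrow> c + (\<integral>\<^sup>+ y. V (st s y) \<partial>P (pr s)) \<le> V s"
    and s: "s \<in> I"
  shows "(\<integral>\<^sup>+ \<omega>. loss_upto st pr fin c t s \<omega> \<partial>stream_space (measure_pmf (Pi_pmf A d P))) \<le> V s"
  using s
proof (induction t arbitrary: s)
  let ?Q = "measure_pmf (Pi_pmf A d P)"
  interpret S: prob_space "stream_space ?Q"
    by (intro prob_space.prob_space_stream_space measure_pmf.prob_space_axioms)
  note const = S.emeasure_space_1
  {
    case 0
    then show ?case
      using final[of s] const by (auto split: option.splits)
  next
    case (Suc t)
    show ?case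
    proof (cases "fin s")
      case None
      have "(\<integral>\<^sup>+ \<omega>. loss_upto st pr fin c (Suc t) s \<omega> \<partial>stream_space ?Q)
          = (\<integral>\<^sup>+ x. \<integral>\<^sup>+ \<omega>. loss_upto st pr fin c (Suc t) s (x ## \<omega>) \<partial>stream_space ?Q \<partial>?Q)"
        by (rule prob_space.nn_integral_stream_space[OF measure_pmf.prob_space_axioms
              measurable_loss_upto])
      also have "\<dots> = (\<integral>\<^sup>+ x. c + (\<integral>\<^sup>+ \<omega>. loss_upto st pr fin c t (st s (x (pr s))) \<omega>
          \<partial>stream_space ?Q) \<partial>?Q)"
        using None const by (simp add: nn_integral_add measurable_loss_upto)
      also have "\<dots> \<le> (\<integral>\<^sup>+ x. c + V (st s (x (pr s))) \<partial>?Q)"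
        by (intro nn_integral_mono add_left_mono Suc.IH step Suc.prems None)
      also have "\<dots> = (\<integral>\<^sup>+ y. c + V (st s y) \<partial>map_pmf (\<lambda>x. x (pr s)) (Pi_pmf A d P))"
        by simp
      also have "\<dots> = c + (\<integral>\<^sup>+ y. V (st s y) \<partial>P (pr s))"
        using probe[OF Suc.prems None]
        by (simp only: Pi_pmf_component[OF fin_A] if_True)
          (simp add: nn_integral_add)
      also have "\<dots> \<le> V s"
        by (rule super[OF Suc.prems None])
      finally show ?thesis .
    next
      case (Some x)
      then show ?thesis
        using final[OF Suc.prems Some] const by simp
    qed
  }
qed

section \<open>The IRW policy as a controlled observation process\<close>

lemma finite_tree_nodes: "finite (tree_nodes k)"
proof (rule finite_subset)
  show "tree_nodes k \<subseteq> {..k} \<times> {..<2 ^ k}"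
    by (auto simp: tree_nodes_def elim!: less_le_trans)
qed simp

lemma irw_state_hist:
  "irw_state k f g K tie c (hist (irw k f g K tie c) \<omega> t) =
    trajectory (irw_step k f g K tie c) (irw_probe K) (At (k, 0) []) \<omega> t"
proof (induction t)
  case 0
  show ?case by (simp add: irw_state_def)
next
  case (Suc t)
  let ?\<Gamma> = "irw k f g K tie c"
  have "irw_state k f g K tie c (hist ?\<Gamma> \<omega> (Suc t)) =
    irw_step k f g K tie c (irw_state k f g K tie c (hist ?\<Gamma> \<omega> t))
      ((\<omega> !! t) (select ?\<Gamma> (hist ?\<Gamma> \<omega> t)))"
    by (simp add: irw_state_def Let_def)
  also have "select ?\<Gamma> (hist ?\<Gamma> \<omega> t) = irw_probe K (irw_state k f g K tie c (hist ?\<Gamma> \<omega> t))"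
    by (simp add: irw_def)
  finally show ?case
    by (simp only: Suc.IH trajectory_Suc_snth)
qed

fun irw_loss :: "nat \<Rightarrow> 'o walk_state \<Rightarrow> ennreal option" where
  "irw_loss m (At v ys) = None"
| "irw_loss m (Declared j) = Some (of_bool (j \<noteq> m))"

lemma irw_loss_eq_None_iff: "irw_loss m s = None \<longleftrightarrow> (\<forall>j. s \<noteq> Declared j)"
  by (cases s) auto

text \<open>On a run that stops, the horizon equal to the stopping time already realizes the whole
  loss. On a run that never stops, the truncated losses \<open>c * t\<close> are unbounded, so the
  supremum is infinite.\<close>

lemma irw_realized_loss_le:
  fixes c :: real and f g :: "nat \<Rightarrow> 'o pmf"
  assumes "c > 0"
  shows "of_bool (\<not> declares (irw k f g K tie c) m \<omega>) +
      ennreal c * ennreal_of_enat (stop_time (irw k f g K tie c) \<omega>)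
    \<le> (SUP t. loss_upto (irw_step k f g K tie c) (irw_probe K) (irw_loss m) (ennreal c) t
          (At (k, 0) []) \<omega>)"
    (is "?lhs \<le> (SUP t. ?loss t)")
proof -
  let ?\<Gamma> = "irw k f g K tie c"
  let ?tr = "trajectory (irw_step k f g K tie c) (irw_probe K) (At (k, 0) []) \<omega>"
  have halt: "halt ?\<Gamma> (hist ?\<Gamma> \<omega> t) \<longleftrightarrow> irw_loss m (?tr t) \<noteq> None" for t
    unfolding irw_loss_eq_None_iff by (simp add: irw_def irw_state_hist[unfolded irw_def])
  show ?thesis
  proof (cases "stop_time ?\<Gamma> \<omega>")
    case (enat t)
    then have run: "irw_loss m (?tr j) = None" if "j < t" for j
      using that halt by (simp add: stop_time_eq_enat_iff)
    from enat have "halt ?\<Gamma> (hist ?\<Gamma> \<omega> t)"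
      by (simp add: stop_time_eq_enat_iff)
    then obtain j where j: "?tr t = Declared j"
      unfolding halt by (cases "?tr t") auto
    have "declares ?\<Gamma> m \<omega> \<longleftrightarrow> j = m"
      using j irw_state_hist[of k f g K tie c \<omega> t]
      by (simp add: declares_def enat) (simp add: irw_def)
    then have "?lhs = ?loss t"
      using enat j loss_upto_eq[of t "irw_loss m", OF run]
      by (simp add: add.commute ennreal_of_enat_def)
    then show ?thesis
      by (metis SUP_upper UNIV_I)
  next
    case infinity
    then have run: "irw_loss m (?tr j) = None" for j
      using halt by (simp add: stop_time_eq_infinity_iff)
    have "?loss t = ennreal c * of_nat t" for t
      using loss_upto_eq[of t "irw_loss m", OF run] run[of t] by simp
    then have "(SUP t. ?loss t) = ennreal c * (SUP t. of_nat t)"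
      by (simp add: SUP_mult_left_ennreal)
    also have "\<dots> = \<top>"
      using assms by (simp add: ennreal_SUP_of_nat_eq_top ennreal_mult_top)
    finally have "(SUP t. ?loss t) = \<top>" .
    then show ?thesis by (simp only: top_greatest)
  qed
qed

text \<open>The truncated bound holds at every horizon with the same right-hand side, so monotone
  convergence passes it to the full loss. \<open>I\<close> is an invariant set of states that
  contains the start.\<close>

lemma irw_expected_loss_le:
  fixes k :: nat and c :: real and f g :: "nat \<Rightarrow> 'o::countable pmf" and K :: "nat \<Rightarrow> nat"
    and tie :: "node \<Rightarrow> 'o list \<Rightarrow> bool" and V :: "'o walk_state \<Rightarrow> ennreal"
  defines "st \<equiv> irw_step k f g K tie c"
  assumes c: "c > 0"
    and init: "At (k, 0) [] \<in> I"
    and probe: "\<And>v ys. At v ys \<in> I \<Longrightarrow> irw_probe K (At v ys) \<in> tree_nodes k"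
    and step: "\<And>v ys y. At v ys \<in> I \<Longrightarrow> st (At v ys) y \<in> I"
    and wrong: "\<And>j. j \<noteq> m \<Longrightarrow> 1 \<le> V (Declared j)"
    and super: "\<And>v ys. At v ys \<in> I \<Longrightarrow>
      ennreal c + (\<integral>\<^sup>+ y. V (st (At v ys) y) \<partial>obs_law f g m (irw_probe K (At v ys))) \<le> V (At v ys)"
  shows "(\<integral>\<^sup>+ \<omega>. (of_bool (\<not> declares (irw k f g K tie c) m \<omega>) +
      ennreal c * ennreal_of_enat (stop_time (irw k f g K tie c) \<omega>)) \<partial>hyp_measure k f g m)
    \<le> V (At (k, 0) [])"
proof -
  let ?loss = "\<lambda>t. loss_upto st (irw_probe K) (irw_loss m) (ennreal c) t (At (k, 0) [])"
  have "(\<integral>\<^sup>+ \<omega>. (of_bool (\<not> declares (irw k f g K tie c) m \<omega>) +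
      ennreal c * ennreal_of_enat (stop_time (irw k f g K tie c) \<omega>)) \<partial>hyp_measure k f g m)
    \<le> (\<integral>\<^sup>+ \<omega>. (SUP t. ?loss t \<omega>) \<partial>hyp_measure k f g m)"
    unfolding st_def by (intro nn_integral_mono irw_realized_loss_le c)
  also have "\<dots> = (SUP t. \<integral>\<^sup>+ \<omega>. ?loss t \<omega> \<partial>hyp_measure k f g m)"
    unfolding hyp_measure_def
    by (intro nn_integral_monotone_convergence_SUP measurable_loss_upto incseq_SucI le_funI
        loss_upto_mono)
  also have "\<dots> \<le> V (At (k, 0) [])"
  proof (rule SUP_least)
    fix t
    show "(\<integral>\<^sup>+ \<omega>. ?loss t \<omega> \<partial>hyp_measure k f g m) \<le> V (At (k, 0) [])"
      unfolding hyp_measure_def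
    proof (rule nn_integral_loss_upto_le[OF finite_tree_nodes _ _ _ _ init])
      fix s x assume "s \<in> I" "irw_loss m s = Some x"
      then show "x \<le> V s" using wrong by (cases s) (auto simp: of_bool_def)
    next
      fix s assume "s \<in> I" "irw_loss m s = None"
      then show "irw_probe K s \<in> tree_nodes k"
        "ennreal c + (\<integral>\<^sup>+ y. V (st s y) \<partial>obs_law f g m (irw_probe K s)) \<le> V s"
        "st s y \<in> I" for y
        using probe super step by (cases s; simp)+
    qed
  qed
  finally show ?thesis .
qed

subsection \<open>Bernoulli log-likelihood ratios\<close>

definition score :: "bool list \<Rightarrow> int" where
  "score ys = (\<Sum>y\<leftarrow>ys. if y then 1 else - 1)"

lemma score_simps [simp]:
  "score [] = 0"
  "score (y # ys) = (if y then 1 else - 1) + score ys"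
  "score (xs @ ys) = score xs + score ys"
  by (simp_all add: score_def)

lemma score_eq: "score ys = 2 * int (length (filter id ys)) - int (length ys)"
  by (induction ys) auto

text \<open>Swapping success and failure probabilities makes every log-likelihood ratio plus or
  minus the same constant. The SLLR is thus a simple walk on a lattice, which later gives exact exit
  values.\<close>

lemma sllr_bernoulli:
  assumes "f l = bernoulli_pmf q" "g l = bernoulli_pmf (1 - q)" "0 < q" "q < 1"
  shows "sllr f g l ys = ln ((1 - q) / q) * score ys"
proof (induction ys)
  case Nil
  then show ?case by (simp add: sllr_def)
next
  case (Cons y ys)
  have "ln (pmf (g l) y / pmf (f l) y) = ln ((1 - q) / q) * (if y then 1 else - 1)"
    using assms by (cases y) (simp_all add: ln_div)
  then show ?case
    using Cons by (simp add: sllr_def algebra_simps)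
qed

lemma KL_pmf_bernoulli:
  assumes "0 < q" "q < 1"
  shows "KL_pmf (bernoulli_pmf (1 - q)) (bernoulli_pmf q) = (1 - 2 * q) * ln ((1 - q) / q)"
proof -
  have sf: "sigma_finite_measure (count_space (UNIV :: bool set))"
    by (intro sigma_finite_measure_count_space_countable) simp
  have "KL_pmf (bernoulli_pmf (1 - q)) (bernoulli_pmf q) =
    (\<integral>y. pmf (bernoulli_pmf (1 - q)) y *
      log (exp 1) (pmf (bernoulli_pmf (1 - q)) y / pmf (bernoulli_pmf q) y) \<partial>count_space UNIV)"
    unfolding KL_pmf_def measure_pmf_eq_density
    by (rule sigma_finite_measure.KL_density_density[OF sf])
      (use assms in \<open>auto simp: AE_count_space pmf_eq_0_set_pmf set_pmf_bernoulli\<close>)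
  also have "\<dots> = (1 - 2 * q) * ln ((1 - q) / q)"
    using assms
    by (simp add: lebesgue_integral_count_space_finite UNIV_bool log_def ln_div algebra_simps)
  finally show ?thesis .
qed

text \<open>A nonnegative score means a success frequency of at least 1/2, which exceeds the mean by
  \<open>1 / 2 - q\<close>; Hoeffding's bound for the binomial law applies.\<close>

lemma prob_score_nonneg_le:
  assumes "0 \<le> q" "q \<le> 1 / 2" "n > 0"
  shows "measure_pmf.prob (replicate_pmf n (bernoulli_pmf q)) {ys. score ys \<ge> 0}
    \<le> exp (- 2 * real n * (1 / 2 - q)\<^sup>2)"
proof -
  interpret binomial_distribution n q
    using assms by unfold_locales auto
  let ?R = "replicate_pmf n (bernoulli_pmf q)"
  have "measure_pmf.prob ?R {ys. score ys \<ge> 0}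
    = measure_pmf.prob ?R ((length \<circ> filter id) -` {x. real x / n \<ge> q + (1 / 2 - q)})"
  \<comment> \<open>The two descriptions of the event agree only for lists of length
    \<open>n\<close>, that is, on the support.\<close>
  proof (rule measure_pmf.finite_measure_eq_AE)
    show "AE ys in ?R. ys \<in> {ys. score ys \<ge> 0} \<longleftrightarrow>
      ys \<in> (length \<circ> filter id) -` {x. real x / n \<ge> q + (1 / 2 - q)}"
      using \<open>n > 0\<close>
      by (auto simp: AE_measure_pmf_iff set_replicate_pmf score_eq field_simps)
  qed simp_all
  also have "\<dots> = measure_pmf.prob (binomial_pmf n q) {x. real x / n \<ge> q + (1 / 2 - q)}"
    using assms by (simp add: binomial_pmf_altdef)
  also have "\<dots> \<le> exp (- 2 * real n * (1 / 2 - q)\<^sup>2)"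
    using assms prob_ge'[of "1 / 2 - q"] by simp
  finally show ?thesis .
qed

lemma prob_score_nonpos_le:
  assumes "0 \<le> q" "q \<le> 1 / 2" "n > 0"
  shows "measure_pmf.prob (replicate_pmf n (bernoulli_pmf (1 - q))) {ys. score ys \<le> 0}
    \<le> exp (- 2 * real n * (1 / 2 - q)\<^sup>2)"
proof -
  interpret binomial_distribution n "1 - q"
    using assms by unfold_locales auto
  let ?R = "replicate_pmf n (bernoulli_pmf (1 - q))"
  have "measure_pmf.prob ?R {ys. score ys \<le> 0}
    = measure_pmf.prob ?R ((length \<circ> filter id) -` {x. real x / n \<le> (1 - q) - (1 / 2 - q)})"
  proof (rule measure_pmf.finite_measure_eq_AE)
    show "AE ys in ?R. ys \<in> {ys. score ys \<le> 0} \<longleftrightarrow>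
      ys \<in> (length \<circ> filter id) -` {x. real x / n \<le> (1 - q) - (1 / 2 - q)}"
      using \<open>n > 0\<close>
      by (auto simp: AE_measure_pmf_iff set_replicate_pmf score_eq field_simps)
  qed simp_all
  also have "\<dots> = measure_pmf.prob (binomial_pmf n (1 - q)) {x. real x / n \<le> (1 - q) - (1 / 2 - q)}"
    using assms by (simp add: binomial_pmf_altdef)
  also have "\<dots> \<le> exp (- 2 * real n * (1 / 2 - q)\<^sup>2)"
    using assms prob_le'[of "1 / 2 - q"] by simp
  finally show ?thesis .
qed

text \<open>With \<open>e\<close> the one-sided Hoeffding bound, both adequacy probabilities are at
  least \<open>(1 - e)\<^sup>2\<close>: for \<open>p_g\<close> it suffices that the target child
  scores positive and the other one negative.\<close>

lemma adequate_size_bernoulli: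
  fixes q :: real
  assumes f: "f (l - 1) = bernoulli_pmf q" and g: "g (l - 1) = bernoulli_pmf (1 - q)"
    and q: "0 < q" "q < 1 / 2" and n: "n > 0"
    and small: "2 * exp (- 2 * real n * (1 / 2 - q)\<^sup>2) < 1 - p"
  shows "adequate_size p f g l n"
proof -
  define e where "e = exp (- 2 * real n * (1 / 2 - q)\<^sup>2)"
  let ?F = "replicate_pmf n (f (l - 1))" and ?G = "replicate_pmf n (g (l - 1))"
  have llr: "ln ((1 - q) / q) > 0"
    using q by (simp add: ln_div)
  have sllr: "sllr f g (l - 1) ys = ln ((1 - q) / q) * score ys" for ys
    by (rule sllr_bernoulli) (use f g q in auto)
  have "{ys. score ys < 0} = UNIV - {ys. score ys \<ge> 0}"
    "{ys. score ys > 0} = UNIV - {ys. score ys \<le> 0}"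
    by auto
  then have F: "measure_pmf.prob ?F {ys. score ys < 0} \<ge> 1 - e"
    and G: "measure_pmf.prob ?G {ys. score ys > 0} \<ge> 1 - e"
    using prob_score_nonneg_le[of q n] prob_score_nonpos_le[of q n] q n
    using measure_pmf.prob_compl[of "{ys. score ys \<ge> 0}" ?F]
      measure_pmf.prob_compl[of "{ys. score ys \<le> 0}" ?G]
    unfolding f g e_def by simp_all
  have e: "2 * e < 1 - p" "0 < e" "e \<le> 1"
    using small by (simp_all add: e_def)
  \<comment> \<open>The square is at least \<open>1 - 2 * e\<close>, which exceeds \<open>p\<close>
    by \<open>small\<close>.\<close>
  have sq: "(1 - e)\<^sup>2 > p"
    using e by (simp add: power2_eq_square algebra_simps) (smt (verit) zero_le_square)
  have "p < (1 - e)\<^sup>2" by (rule sq)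
  also have "\<dots> \<le> (measure_pmf.prob ?F {ys. score ys < 0})\<^sup>2"
    using F e by (intro power_mono) auto
  finally have "p_f f g l n > p"
    unfolding p_f_def sllr using llr by (simp add: mult_less_0_iff)
  moreover have "p_g f g l n > p"
  proof -
    have "p < (1 - e) * (1 - e)" using sq by (simp add: power2_eq_square)
    also have "\<dots> \<le> measure_pmf.prob ?G {ys. score ys > 0} * measure_pmf.prob ?F {ys. score ys < 0}"
      using F G e by (intro mult_mono) auto
    also have "\<dots> = measure_pmf.prob (pair_pmf ?G ?F) ({ys. score ys > 0} \<times> {ys. score ys < 0})"
      by (intro measure_pmf_prob_product[symmetric]) auto
    also have "\<dots> \<le> p_g f g l n"
      unfolding p_g_def sllr using llr
      by (intro measure_pmf.finite_measure_mono)
        (auto simp: zero_less_mult_iff mult_less_cancel_left)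
    finally show ?thesis .
  qed
  ultimately show ?thesis
    by (simp add: adequate_size_def)
qed

text \<open>With no samples both sums are 0, and the strict comparison in \<open>p_g\<close> has
  probability 0.\<close>

lemma adequate_size_pos: "adequate_size p f g l n \<Longrightarrow> p > 0 \<Longrightarrow> n > 0"
  by (rule ccontr) (simp add: adequate_size_def p_g_def sllr_def)

subsection \<open>Visits to internal nodes\<close>

lemma ancestor_parent: "m div 2 ^ l = i \<Longrightarrow> m div 2 ^ Suc l = i div 2" for m l i :: nat
  by (metis div_mult2_eq mult.commute power_Suc)

text \<open>This is the path length from (l, i) to leaf m: climb to the first ancestor of m, then
  descend by its level. The climb runs in a tree unbounded above, so the depth k does not
  enter.\<close>

function target_dist :: "nat \<Rightarrow> nat \<Rightarrow> nat \<Rightarrow> nat" where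
  "target_dist m l i =
    (if m div 2 ^ l = i then l else Suc (target_dist m (Suc l) (i div 2)))"
  by pat_completeness auto
termination
proof (relation "Wellfounded.measure (\<lambda>(m, l, i). m div 2 ^ l + i)")
  fix m l i :: nat
  \<comment> \<open>Two different indices cannot both be 0, so halving both strictly decreases their
    sum.\<close>
  assume "m div 2 ^ l \<noteq> i"
  then have "(m div 2 ^ l) div 2 + i div 2 < m div 2 ^ l + i"
    by linarith
  then show "((m, Suc l, i div 2), m, l, i) \<in> Wellfounded.measure (\<lambda>(m, l, i). m div 2 ^ l + i)"
    by (simp add: ancestor_parent[OF refl] del: power_Suc)
qed simp

declare target_dist.simps [simp del]

lemma target_dist_on: "m div 2 ^ l = i \<Longrightarrow> target_dist m l i = l"
  by (subst target_dist.simps) simp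

lemma target_dist_off:
  "m div 2 ^ l \<noteq> i \<Longrightarrow> target_dist m l i = Suc (target_dist m (Suc l) (i div 2))"
  by (subst target_dist.simps) simp

lemma target_dist_child_le: "target_dist m l i \<le> Suc (target_dist m (Suc l) (i div 2))"
  using target_dist_on[of m l i] target_dist_off[of m l i]
    target_dist_on[OF ancestor_parent[of m l i]]
  by (cases "m div 2 ^ l = i") auto

lemma target_dist_parent_le: "target_dist m (Suc l) (i div 2) \<le> Suc (target_dist m l i)"
  using target_dist_on[of m l i] target_dist_off[of m l i]
    target_dist_on[OF ancestor_parent[of m l i]]
  by (cases "m div 2 ^ l = i") auto

lemma target_dist_pos: "0 < l \<Longrightarrow> 0 < target_dist m l i"
  using target_dist_on[of m l i] target_dist_off[of m l i]
  by (cases "m div 2 ^ l = i") auto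

lemma target_dist_leaf [simp]: "target_dist m 0 m = 0"
  by (simp add: target_dist_on)

section \<open>The move that ends a visit to an internal node\<close>

definition irw_move ::
  "nat \<Rightarrow> (nat \<Rightarrow> 'o pmf) \<Rightarrow> (nat \<Rightarrow> 'o pmf) \<Rightarrow> (nat \<Rightarrow> nat) \<Rightarrow> (node \<Rightarrow> 'o list \<Rightarrow> bool)
    \<Rightarrow> nat \<Rightarrow> nat \<Rightarrow> 'o list \<Rightarrow> node" where
  "irw_move k f g K tie l i ys =
    (let a = sllr f g (l - 1) (take (K l) ys);
         b = sllr f g (l - 1) (drop (K l) ys)
     in if a < 0 \<and> b < 0 then parent k (l, i)
        else if a > b \<or> (a = b \<and> tie (l, i) ys) then (l - 1, 2 * i)
        else (l - 1, 2 * i + 1))"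

lemma irw_step_internal:
  assumes "l > 0"
  shows "irw_step k f g K tie c (At (l, i) ys) y =
    (if Suc (length ys) < 2 * K l then At (l, i) (ys @ [y])
     else At (irw_move k f g K tie l i (ys @ [y])) [])"
  using assms by (simp add: irw_move_def Let_def)

lemma parent_in_tree_nodes: "v \<in> tree_nodes k \<Longrightarrow> parent k v \<in> tree_nodes k"
proof (cases v)
  fix l i assume v: "v \<in> tree_nodes k" "v = (l, i)"
  show ?thesis
  proof (cases "l < k")
    case True
    then have "k - l = Suc (k - Suc l)" by simp
    then show ?thesis using v True by (auto simp: tree_nodes_def parent_def)
  qed (use v in \<open>simp add: parent_def\<close>)
qed

lemma children_in_tree_nodes:
  assumes "(l, i) \<in> tree_nodes k" "l > 0"
  shows "(l - 1, 2 * i) \<in> tree_nodes k" "(l - 1, Suc (2 * i)) \<in> tree_nodes k"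
proof -
  have "k - (l - 1) = Suc (k - l)"
    using assms by (auto simp: tree_nodes_def)
  then show "(l - 1, 2 * i) \<in> tree_nodes k" "(l - 1, Suc (2 * i)) \<in> tree_nodes k"
    using assms by (auto simp: tree_nodes_def)
qed

lemma irw_move_in_tree_nodes:
  assumes "(l, i) \<in> tree_nodes k" "l > 0"
  shows "irw_move k f g K tie l i ys \<in> tree_nodes k"
  using children_in_tree_nodes[OF assms] parent_in_tree_nodes[OF assms(1)]
  by (simp add: irw_move_def Let_def)

lemma target_dist_irw_move_le:
  assumes "l > 0" and "irw_move k f g K tie l i ys = (l', i')"
  shows "target_dist m l' i' \<le> Suc (target_dist m l i)"
proof -
  from \<open>l > 0\<close> obtain n where "l = Suc n" by (cases l) auto
  with assms show ?thesis
    using target_dist_child_le[of m n "2 * i"] target_dist_child_le[of m n "Suc (2 * i)"]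
      target_dist_parent_le[of m l i]
    by (auto simp: irw_move_def Let_def parent_def split: if_splits)
qed

text \<open>These are the sample outcomes that force a step towards the target; strict inequalities
  decide the move without a tie-break.\<close>

definition right_move_event ::
  "(nat \<Rightarrow> 'o pmf) \<Rightarrow> (nat \<Rightarrow> 'o pmf) \<Rightarrow> nat \<Rightarrow> nat \<Rightarrow> nat \<Rightarrow> ('o list \<times> 'o list) set" where
  "right_move_event f g m l i = {(xs, ws).
    let a = sllr f g (l - 1) xs; b = sllr f g (l - 1) ws
    in if m div 2 ^ l \<noteq> i then a < 0 \<and> b < 0
       else if m div 2 ^ (l - 1) = 2 * i then a > max b 0
       else b > max a 0}"

lemma target_child_cases:
  assumes "m div 2 ^ l = i" "l > (0::nat)"
  shows "m div 2 ^ (l - 1) = 2 * i \<or> m div 2 ^ (l - 1) = Suc (2 * i)"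
proof -
  from assms ancestor_parent[of m "l - 1", OF refl] have "(m div 2 ^ (l - 1)) div 2 = i"
    by simp
  then show ?thesis by linarith
qed

lemma target_dist_right_move:
  assumes tree: "(l, i) \<in> tree_nodes k" and m: "m < 2 ^ k" and l: "l > 0"
    and len: "length xs = K l" and ev: "(xs, ws) \<in> right_move_event f g m l i"
    and move: "irw_move k f g K tie l i (xs @ ws) = (l', i')"
  shows "target_dist m l i = Suc (target_dist m l' i')"
proof (cases "m div 2 ^ l = i")
  case False
  \<comment> \<open>The root lies above every leaf, so a node off the target path has a proper
    parent and the upward move is not the self-loop at the root.\<close>
  have "l < k"
  proof (rule ccontr)
    assume "\<not> l < k"
    then have "l = k" "i = 0" using tree by (auto simp: tree_nodes_def)
    with False m show False by simp
  qed
  with False ev len move show ?thesis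
    by (auto simp: right_move_event_def irw_move_def Let_def parent_def target_dist_off)
next
  case True
  have "l' = l - 1 \<and> m div 2 ^ (l - 1) = i'"
    using target_child_cases[OF True l] ev len move True
    by (auto simp: right_move_event_def irw_move_def Let_def split: if_splits)
  then show ?thesis
    using True l by (simp add: target_dist_on)
qed

text \<open>Off the target path both children follow \<open>f\<close>, and independence gives
  exactly \<open>p_f\<close>. On it, one child follows \<open>g\<close> and the event has
  probability \<open>p_g\<close>, after exchanging the two samples if the target is on the
  right.\<close>

lemma prob_right_move_event_ge:
  fixes f g :: "nat \<Rightarrow> 'o::countable pmf"
  assumes adequate: "adequate_size p f g l n" and l: "l > 0"
  shows "measure_pmf.prob (pair_pmf (replicate_pmf n (obs_law f g m (l - 1, 2 * i)))
      (replicate_pmf n (obs_law f g m (l - 1, Suc (2 * i))))) (right_move_event f g m l i) \<ge> p"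
    (is "measure_pmf.prob (pair_pmf ?L ?R) _ \<ge> p")
proof -
  let ?F = "replicate_pmf n (f (l - 1))" and ?G = "replicate_pmf n (g (l - 1))"
  let ?s = "sllr f g (l - 1)"
  from adequate have pg: "p_g f g l n > p" and pf: "p_f f g l n > p"
    by (auto simp: adequate_size_def)
  consider "m div 2 ^ l \<noteq> i" | "m div 2 ^ l = i" "m div 2 ^ (l - 1) = 2 * i"
    | "m div 2 ^ l = i" "m div 2 ^ (l - 1) = Suc (2 * i)"
    using target_child_cases[OF _ l] by blast
  then show ?thesis
  proof cases
    case 1
    have "m div 2 ^ (l - 1) \<noteq> j" if "j div 2 = i" for j
      using 1 ancestor_parent[of m "l - 1" j] that l by auto
    from this[of "2 * i"] this[of "Suc (2 * i)"]
    have LR: "?L = ?F" "?R = ?F"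
      by (auto simp: obs_law_def subtree_contains_def)
    have "right_move_event f g m l i = {xs. ?s xs < 0} \<times> {xs. ?s xs < 0}"
      using 1 by (auto simp: right_move_event_def Let_def)
    then have "measure_pmf.prob (pair_pmf ?L ?R) (right_move_event f g m l i) = p_f f g l n"
      unfolding LR p_f_def power2_eq_square
      by (simp add: measure_pmf_prob_product countableI_type)
    with pf show ?thesis by simp
  next
    case 2
    then have LR: "?L = ?G" "?R = ?F"
      by (auto simp: obs_law_def subtree_contains_def)
    have "right_move_event f g m l i = {(ys, zs). ?s ys > max (?s zs) 0}"
      using 2 by (auto simp: right_move_event_def Let_def)
    then show ?thesis
      using pg unfolding LR p_g_def by simp
  next
    case 3
    then have LR: "?L = ?F" "?R = ?G"
      by (auto simp: obs_law_def subtree_contains_def)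
    have "right_move_event f g m l i = {(ys, zs). ?s zs > max (?s ys) 0}"
      using 3 by (auto simp: right_move_event_def Let_def)
    then have "measure_pmf.prob (pair_pmf ?L ?R) (right_move_event f g m l i) = p_g f g l n"
      unfolding LR p_g_def by (subst pair_commute_pmf) (auto intro!: arg_cong2[where f = measure])
    with pg show ?thesis by simp
  qed
qed

section \<open>Sampling cost and drift of one visit\<close>

lemma nn_integral_replicate_Suc:
  "(\<integral>\<^sup>+ xs. F xs \<partial>replicate_pmf (Suc n) P) = (\<integral>\<^sup>+ x. \<integral>\<^sup>+ xs. F (x # xs) \<partial>replicate_pmf n P \<partial>P)"
  by simp

lemma nn_integral_pmf_const_add: "(\<integral>\<^sup>+ x. a + F x \<partial>measure_pmf P) = a + (\<integral>\<^sup>+ x. F x \<partial>measure_pmf P)"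
  for a :: ennreal
  by (simp add: nn_integral_add)

text \<open>The sampling cost of the rest of a visit to an internal node with samples \<open>ys\<close> so far,
  plus the expectation of U at the node the walk moves to.\<close>

definition visit_value ::
  "nat \<Rightarrow> (nat \<Rightarrow> 'o pmf) \<Rightarrow> (nat \<Rightarrow> 'o pmf) \<Rightarrow> (nat \<Rightarrow> nat) \<Rightarrow> (node \<Rightarrow> 'o list \<Rightarrow> bool) \<Rightarrow> real
    \<Rightarrow> nat \<Rightarrow> (node \<Rightarrow> ennreal) \<Rightarrow> nat \<Rightarrow> nat \<Rightarrow> 'o list \<Rightarrow> ennreal" where
  "visit_value k f g K tie c m U l i ys =
    ennreal c * of_nat (2 * K l - length ys) +
    (\<integral>\<^sup>+ xs. \<integral>\<^sup>+ ws. U (irw_move k f g K tie l i (ys @ xs @ ws))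
      \<partial>replicate_pmf (2 * K l - max (K l) (length ys)) (obs_law f g m (l - 1, Suc (2 * i)))
      \<partial>replicate_pmf (K l - length ys) (obs_law f g m (l - 1, 2 * i)))"

lemma visit_value_full:
  "length ys = 2 * K l \<Longrightarrow> visit_value k f g K tie c m U l i ys = U (irw_move k f g K tie l i ys)"
  by (simp add: visit_value_def)

text \<open>The next observation is simply the first of the samples still to be drawn, from the left
  child while that list is unfinished and from the right child afterwards. Truncated subtraction
  keeps the two remaining counts correct in both phases.\<close>

lemma visit_value_step:
  assumes "length ys < 2 * K l" "l > 0"
  shows "ennreal c + (\<integral>\<^sup>+ y. visit_value k f g K tie c m U l i (ys @ [y])
      \<partial>obs_law f g m (irw_probe K (At (l, i) ys))) = visit_value k f g K tie c m U l i ys"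
proof -
  define n where "n = 2 * K l - Suc (length ys)"
  have n: "2 * K l - length ys = Suc n"
    using assms by (simp add: n_def)
  have cost: "ennreal c + (ennreal c * of_nat n + x) = ennreal c * of_nat (Suc n) + x" for x
    by (simp add: algebra_simps)
  show ?thesis
  proof (cases "length ys < K l")
    case True
    define j where "j = K l - Suc (length ys)"
    have j: "K l - length ys = Suc j" "2 * K l - max (K l) (length ys) = K l"
      "2 * K l - max (K l) (Suc (length ys)) = K l"
      using True by (simp_all add: j_def)
    show ?thesis
      using True \<open>l > 0\<close>
      by (simp add: visit_value_def n j n_def[symmetric] j_def[symmetric] nn_integral_replicate_Suc
          nn_integral_pmf_const_add cost del: replicate_pmf.simps(2) of_nat_Suc)
  next
    case False
    have j: "K l - length ys = 0" "K l - Suc (length ys) = 0"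
      "2 * K l - max (K l) (length ys) = Suc n" "2 * K l - max (K l) (Suc (length ys)) = n"
      using False n by (simp_all add: n_def)
    show ?thesis
      using False \<open>l > 0\<close>
      by (simp add: visit_value_def n j n_def[symmetric] nn_integral_replicate_Suc
          nn_integral_pmf_const_add cost del: replicate_pmf.simps(2) of_nat_Suc)
  qed
qed

text \<open>The mean distance after the visit is at most \<open>d - p + (1 - p)\<close>, so the
  affine function drops on average by at least \<open>a * (2 * p - 1)\<close>, which pays for the
  \<open>2 * K l\<close> samples.\<close>

lemma visit_value_Nil_le:
  fixes f g :: "nat \<Rightarrow> 'o::countable pmf" and c a b :: real
  assumes tree: "(l, i) \<in> tree_nodes k" and m: "m < 2 ^ k" and l: "l > 0"
    and adequate: "adequate_size p f g l (K l)"
    and nonneg: "c \<ge> 0" "a \<ge> 0" "b \<ge> 0"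
    and drift: "2 * c * K l \<le> a * (2 * p - 1)"
  shows "visit_value k f g K tie c m (\<lambda>(l, i). ennreal (b + a * target_dist m l i)) l i []
    \<le> ennreal (b + a * target_dist m l i)"
proof -
  define PL where "PL = replicate_pmf (K l) (obs_law f g m (l - 1, 2 * i))"
  define PR where "PR = replicate_pmf (K l) (obs_law f g m (l - 1, Suc (2 * i)))"
  define U where "U = (\<lambda>(l, i). ennreal (b + a * target_dist m l i))"
  define d where "d = real (target_dist m l i)"
  have d: "d \<ge> 1"
    using target_dist_pos[OF l, of m i] by (simp add: d_def)
  let ?E = "right_move_event f g m l i"
  \<comment> \<open>A right move gives \<open>d - 1\<close>; any other move, including the self-loop
    at the root, gives at most \<open>d + 1\<close>, hence the surcharge \<open>2 * a\<close> off
    the event.\<close>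
  have pt: "U (irw_move k f g K tie l i (xs @ ws))
      \<le> ennreal (b + a * (d - 1)) + ennreal (2 * a) * indicator (- ?E) (xs, ws)"
    if "xs \<in> set_pmf PL" for xs ws
  proof -
    obtain l' i' where move: "irw_move k f g K tie l i (xs @ ws) = (l', i')"
      by (cases "irw_move k f g K tie l i (xs @ ws)")
    have len: "length xs = K l"
      using that by (simp add: PL_def set_replicate_pmf)
    show ?thesis
    proof (cases "(xs, ws) \<in> ?E")
      case True
      then show ?thesis
        using target_dist_right_move[OF tree m l len True move] move
        by (simp add: U_def d_def)
    next
      case False
      have "b + a * target_dist m l' i' \<le> b + a * (d + 1)"
        using target_dist_irw_move_le[OF l move, of m] nonneg
        by (intro add_left_mono mult_left_mono) (auto simp: d_def)
      also have "\<dots> = (b + a * (d - 1)) + 2 * a"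
        by (simp add: algebra_simps)
      finally have "U (l', i') \<le> ennreal ((b + a * (d - 1)) + 2 * a)"
        unfolding U_def by (simp add: ennreal_leI)
      then show ?thesis
        using False move nonneg d by (simp add: ennreal_plus[symmetric] del: ennreal_plus)
    qed
  qed
  have "(\<integral>\<^sup>+ xs. \<integral>\<^sup>+ ws. U (irw_move k f g K tie l i (xs @ ws)) \<partial>PR \<partial>PL)
    \<le> (\<integral>\<^sup>+ xs. \<integral>\<^sup>+ ws. ennreal (b + a * (d - 1)) + ennreal (2 * a) * indicator (- ?E) (xs, ws) \<partial>PR \<partial>PL)"
    by (intro nn_integral_mono_AE AE_pmfI nn_integral_mono pt)
  also have "\<dots> = ennreal (b + a * (d - 1)) + ennreal (2 * a) * emeasure (pair_pmf PL PR) (- ?E)"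
    by (simp add: nn_integral_pmf_const_add nn_integral_cmult nn_integral_pair_pmf'[symmetric])
  also have "\<dots> \<le> ennreal (b + a * (d - 1)) + ennreal (2 * a) * ennreal (1 - p)"
    using prob_right_move_event_ge[OF adequate l, of m i]
      measure_pmf.prob_compl[of ?E "pair_pmf PL PR"]
    by (intro add_left_mono mult_left_mono)
      (auto simp: measure_pmf.emeasure_eq_measure Compl_eq_Diff_UNIV PL_def PR_def intro!: ennreal_leI)
  finally have "visit_value k f g K tie c m U l i []
    \<le> ennreal c * of_nat (2 * K l) + (ennreal (b + a * (d - 1)) + ennreal (2 * a) * ennreal (1 - p))"
    by (simp add: visit_value_def PL_def PR_def)
  also have "\<dots> = ennreal (c * (2 * K l) + (b + a * (d - 1) + 2 * a * (1 - p)))"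
  proof -
    have "p \<le> 1"
      using adequate by (auto simp: adequate_size_def p_g_def intro: less_imp_le less_le_trans)
    then show ?thesis
      using nonneg d
      by (simp add: ennreal_plus[symmetric] ennreal_mult[symmetric] ennreal_of_nat_eq_real_of_nat
          del: ennreal_plus)
  qed
  also have "\<dots> \<le> ennreal (b + a * d)"
    using drift by (intro ennreal_leI) (simp add: algebra_simps)
  finally show ?thesis
    by (simp add: U_def d_def)
qed

subsection \<open>The supersolution\<close>

text \<open>\<open>a\<close> is the slope per unit of sampling cost. \<open>drift\<close> finances
  internal visits. In \<open>leaf_drift\<close>, \<open>1 / (1 - 2 * q)\<close> bounds the mean
  number of samples at a wrong leaf, and the extra 1 covers the false-alarm charge
  \<open>c / k\<close>.\<close>

locale bernoulli_leaf_irw =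
  fixes k m :: nat and f g :: "nat \<Rightarrow> bool pmf" and K :: "nat \<Rightarrow> nat"
    and tie :: "node \<Rightarrow> bool list \<Rightarrow> bool" and c p q a :: real
  assumes k: "k \<ge> 1" and m: "m < 2 ^ k" and c: "0 < c" "c < 1"
    and f0: "f 0 = bernoulli_pmf q" and g0: "g 0 = bernoulli_pmf (1 - q)"
    and q: "0 < q" "q < 1 / 2" and p: "1 / 2 < p"
    and adequate: "\<And>l. l \<in> {1..k} \<Longrightarrow> adequate_size p f g l (K l)"
    and drift: "\<And>l. l \<in> {1..k} \<Longrightarrow> 2 * real (K l) \<le> a * (2 * p - 1)"
    and leaf_drift: "1 / (1 - 2 * q) + 1 \<le> a"
begin

definition "llr = ln ((1 - q) / q)"
definition "kl = (1 - 2 * q) * llr"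
definition "thr = ln (real k / c)"
text \<open>The value on arrival at the target leaf. In the first summand \<open>llr\<close> allows
  for overshoot: a lattice step carries the SLLR at most \<open>llr\<close> beyond
  \<open>thr\<close>.\<close>

definition "base = c * (thr + llr) / kl + c * a * q / (1 - 2 * q)"

definition node_value :: "nat \<Rightarrow> nat \<Rightarrow> real" where
  "node_value l i = base + (c * a) * target_dist m l i"

text \<open>At a leaf with current SLLR S the walk is a gambler's ruin: under the leaf's own law
  \<open>exp (- S)\<close> (target) or \<open>exp S\<close> (otherwise) is a martingale, and the term linear
  in S pays for the samples by Wald's identity. At the target, the factor of \<open>exp (- S)\<close>
  makes the value at \<open>S = - llr\<close> cover the cost of a new excursion from the parent.\<close>

definition leaf_value :: "nat \<Rightarrow> real \<Rightarrow> real" where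
  "leaf_value i S =
    (if i = m then c * (thr + llr - S) / kl + c * a * q / (1 - 2 * q) * exp (- S)
     else node_value 1 (i div 2) + c * (S + llr) / kl + c / k * exp S)"

text \<open>The continuation after a visit is the affine \<open>node_value\<close> rather than the
  value of the next state, which avoids a circular definition; \<open>state_value_At_Nil_le\<close>
  justifies the replacement.\<close>

fun state_value :: "bool walk_state \<Rightarrow> ennreal" where
  "state_value (At (l, i) ys) =
    (if l = 0 then ennreal (leaf_value i (sllr f g 0 ys))
     else visit_value k f g K tie c m (\<lambda>(l, i). ennreal (node_value l i)) l i ys)"
| "state_value (Declared j) = of_bool (j \<noteq> m)"

fun valid_state :: "bool walk_state \<Rightarrow> bool" where
  "valid_state (At (l, i) ys) \<longleftrightarrow> (l, i) \<in> tree_nodes k \<and>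
    (if l = 0 then 0 \<le> sllr f g 0 ys \<and> sllr f g 0 ys \<le> thr else length ys < 2 * K l)"
| "valid_state (Declared j) \<longleftrightarrow> True"

lemma llr_pos: "llr > 0"
  using q by (simp add: llr_def)

lemma exp_llr: "exp llr = (1 - q) / q"
  using q by (simp add: llr_def)

lemma kl_pos: "kl > 0"
  using q llr_pos by (simp add: kl_def)

lemma thr_nonneg: "thr \<ge> 0"
  using k c by (simp add: thr_def)

lemma exp_thr: "exp thr = k / c"
  using k c by (simp add: thr_def)

lemma a_pos: "a > 0"
proof -
  have "1 / (1 - 2 * q) > 0" using q by simp
  with leaf_drift show ?thesis by linarith
qed

lemma base_nonneg: "base \<ge> 0"
  using c kl_pos thr_nonneg llr_pos a_pos q by (simp add: base_def)

lemma node_value_nonneg: "node_value l i \<ge> 0"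
  using base_nonneg c a_pos by (simp add: node_value_def)

lemma sllr0: "sllr f g 0 ys = llr * score ys"
  unfolding llr_def by (rule sllr_bernoulli) (use f0 g0 q in auto)

lemma K_pos: "l \<in> {1..k} \<Longrightarrow> K l > 0"
  using adequate adequate_size_pos p by fastforce

section \<open>Boundary inequalities and the exact one-step identity at leaves\<close>

lemma leaf_value_nonneg:
  assumes "- llr \<le> S" "S \<le> thr + llr"
  shows "leaf_value i S \<ge> 0"
  using assms c kl_pos a_pos q k node_value_nonneg[of 1 "i div 2"] by (simp add: leaf_value_def)

text \<open>At the target, the factor \<open>exp llr = (1 - q) / q\<close> turns the return cost
  \<open>x\<close> into exactly \<open>x + c * a\<close>, the return cost plus one unit of distance.
  At a wrong leaf the parent's value is already a summand.\<close>

lemma leaf_value_exit: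
  "node_value 1 (i div 2) \<le> leaf_value i (- llr)"
proof (cases "i = m")
  case True
  have "m div 2 ^ 1 = m div 2" by simp
  then have "target_dist m (Suc 0) (m div 2) = 1"
    using target_dist_on[of m 1] by simp
  moreover have "c * a * q / (1 - 2 * q) * exp llr = c * a * q / (1 - 2 * q) + c * a"
    using q by (simp add: exp_llr field_simps)
  moreover have "c * (thr + llr) / kl \<le> c * (thr + llr + llr) / kl"
    using c llr_pos kl_pos by (intro divide_right_mono mult_left_mono) auto
  ultimately show ?thesis
    using True by (simp add: leaf_value_def node_value_def base_def)
next
  case False
  then show ?thesis using c k by (simp add: leaf_value_def)
qed

text \<open>The threshold is chosen so that \<open>exp thr = k / c\<close>, which brings the
  exponential term alone up to 1.\<close>

lemma leaf_value_wrong: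
  assumes "i \<noteq> m" "thr \<le> S"
  shows "1 \<le> leaf_value i S"
proof -
  have "1 = c / k * exp thr"
    using c k by (simp add: exp_thr)
  also have "\<dots> \<le> c / k * exp S"
    using assms c by (intro mult_left_mono) auto
  also have "\<dots> \<le> leaf_value i S"
    using assms c kl_pos thr_nonneg llr_pos node_value_nonneg[of 1 "i div 2"]
    by (simp add: leaf_value_def)
  finally show ?thesis .
qed

lemma leaf_value_super:
  "c + (if i = m then (1 - q) * leaf_value i (S + llr) + q * leaf_value i (S - llr)
        else q * leaf_value i (S + llr) + (1 - q) * leaf_value i (S - llr)) = leaf_value i S"
proof -
  \<comment> \<open>\<open>kl\<close> is the absolute drift of the SLLR per sample, so the linear
    term changes by \<open>- c\<close> on average.\<close>
  have lin: "c = c * llr * (1 - 2 * q) / kl"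
    using llr_pos q by (simp add: kl_def)
  \<comment> \<open>The exponential martingale property; it serves both leaf types, with the two
    summands exchanged at a wrong leaf.\<close>
  have mart: "(1 - q) * (A * (q / (1 - q))) + q * (A * ((1 - q) / q)) = A" for A :: real
    using q by (simp add: field_simps)
  have ex: "exp (S + llr) = exp S * ((1 - q) / q)" "exp (S - llr) = exp S * (q / (1 - q))"
    "exp (- (S + llr)) = exp (- S) * (q / (1 - q))" "exp (- (S - llr)) = exp (- S) * ((1 - q) / q)"
    using exp_llr by (simp_all add: exp_add exp_diff exp_minus field_simps)
  have split: "c + (x * (X1 + Y1) + y * (X2 + Y2)) = (c + x * X1 + y * X2) + (x * Y1 + y * Y2)"
    for x y X1 X2 Y1 Y2 :: real
    by (simp add: algebra_simps)
  show ?thesis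
  proof (cases "i = m")
    case True
    define A where "A = c * a * q / (1 - 2 * q) * exp (- S)"
    define X where "X = (\<lambda>S. c * (thr + llr - S) / kl)"
    have val: "leaf_value i (S + llr) = X (S + llr) + A * (q / (1 - q))"
      "leaf_value i (S - llr) = X (S - llr) + A * ((1 - q) / q)"
      "leaf_value i S = X S + A"
      unfolding leaf_value_def A_def X_def ex using True by (simp_all add: mult.assoc)
    have "c * llr * (1 - 2 * q) / kl + (1 - q) * X (S + llr) + q * X (S - llr) = X S"
      unfolding X_def by (simp add: add_divide_distrib[symmetric] algebra_simps)
    then have "c + (1 - q) * X (S + llr) + q * X (S - llr) = X S"
      using lin by linarith
    then show ?thesis
      unfolding if_P[OF True] by (simp only: val split mart)
  next
    case False
    define A where "A = c / k * exp S"
    define X where "X = (\<lambda>S. node_value 1 (i div 2) + c * (S + llr) / kl)"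
    have val: "leaf_value i (S + llr) = X (S + llr) + A * ((1 - q) / q)"
      "leaf_value i (S - llr) = X (S - llr) + A * (q / (1 - q))"
      "leaf_value i S = X S + A"
      unfolding leaf_value_def A_def X_def ex using False by (simp_all add: mult.assoc)
    have "c * llr * (1 - 2 * q) / kl + q * (c * (S + llr + llr) / kl)
        + (1 - q) * (c * (S - llr + llr) / kl) = c * (S + llr) / kl"
      by (simp add: add_divide_distrib[symmetric] algebra_simps)
    then have "c + q * X (S + llr) + (1 - q) * X (S - llr) = X S"
      unfolding X_def using lin by (simp add: distrib_left) (simp add: algebra_simps)
    then show ?thesis
      unfolding if_not_P[OF False] by (simp only: val split mart add.commute[of "q * (A * _)"])
  qed
qed

text \<open>Equality holds at the target. A wrong leaf is one step farther than its parent, so a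
  whole slope \<open>c * a\<close> is available for the samples and the false-alarm charge.\<close>

lemma leaf_value_0_le: "leaf_value i 0 \<le> node_value 0 i"
proof (cases "i = m")
  case True
  then show ?thesis by (simp add: leaf_value_def node_value_def base_def)
next
  case False
  then have dist: "target_dist m 0 i = Suc (target_dist m (Suc 0) (i div 2))"
    by (intro target_dist_off) simp
  have "llr / kl = 1 / (1 - 2 * q)"
    using llr_pos by (simp add: kl_def)
  moreover have "1 / real k \<le> 1"
    using k by simp
  ultimately have "llr / kl + 1 / real k \<le> a"
    using leaf_drift by linarith
  then have "c * (llr / kl + 1 / real k) \<le> c * a"
    using c by (intro mult_left_mono) auto
  then show ?thesis
    using False dist by (simp add: leaf_value_def node_value_def algebra_simps)
qed

lemma state_value_At_Nil_le:
  assumes "(l, i) \<in> tree_nodes k"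
  shows "state_value (At (l, i) []) \<le> ennreal (node_value l i)"
proof (cases "l = 0")
  case True
  then show ?thesis
    using leaf_value_0_le by (simp add: sllr0 ennreal_leI)
next
  case False
  then have l: "l \<in> {1..k}"
    using assms by (auto simp: tree_nodes_def)
  have "2 * c * K l \<le> (c * a) * (2 * p - 1)"
    using mult_left_mono[OF drift[OF l], of c] c by (simp add: algebra_simps)
  with assms m l adequate[OF l] c a_pos base_nonneg
  have "visit_value k f g K tie c m (\<lambda>(l, i). ennreal (base + (c * a) * target_dist m l i)) l i []
      \<le> ennreal (base + (c * a) * target_dist m l i)"
    by (intro visit_value_Nil_le) auto
  then show ?thesis
    using False by (simp only: node_value_def state_value.simps if_False)
qed

section \<open>The one-step inequality at all valid states\<close>

lemma valid_state_At_Nil: "(l, i) \<in> tree_nodes k \<Longrightarrow> valid_state (At (l, i) [])"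
  using K_pos[of l] thr_nonneg by (auto simp: sllr0 tree_nodes_def)

abbreviation "stp \<equiv> irw_step k f g K tie c"

lemma internal_step:
  assumes valid: "valid_state (At (l, i) ys)" and l: "l > 0"
  shows "valid_state (stp (At (l, i) ys) y)"
    and "state_value (stp (At (l, i) ys) y)
      \<le> visit_value k f g K tie c m (\<lambda>(l, i). ennreal (node_value l i)) l i (ys @ [y])"
proof -
  from valid l have tree: "(l, i) \<in> tree_nodes k" and len: "length ys < 2 * K l"
    by auto
  obtain l' i' where move: "irw_move k f g K tie l i (ys @ [y]) = (l', i')"
    by (cases "irw_move k f g K tie l i (ys @ [y])")
  have "(l', i') \<in> tree_nodes k"
    using irw_move_in_tree_nodes[OF tree l, of f g K tie "ys @ [y]"] move by simp
  note new_visit = valid_state_At_Nil[OF this] state_value_At_Nil_le[OF this]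
  show "valid_state (stp (At (l, i) ys) y)"
  proof (cases "Suc (length ys) < 2 * K l")
    case True
    then show ?thesis using tree l by (simp add: irw_step_internal del: irw_step.simps)
  next
    case False
    then show ?thesis
      using l move new_visit(1)
      by (simp add: irw_step_internal del: irw_step.simps valid_state.simps)
  qed
  show "state_value (stp (At (l, i) ys) y)
      \<le> visit_value k f g K tie c m (\<lambda>(l, i). ennreal (node_value l i)) l i (ys @ [y])"
  proof (cases "Suc (length ys) < 2 * K l")
    case True
    then show ?thesis using l by (simp add: irw_step_internal del: irw_step.simps)
  next
    case False
    then have "length (ys @ [y]) = 2 * K l" using len by simp
    from visit_value_full[where K = K, OF this] show ?thesis
      using l move False new_visit(2) by (simp add: irw_step_internal del: irw_step.simps)
  qed
qed

lemma leaf_step: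
  fixes y :: bool
  assumes valid: "valid_state (At (0, i) ys)"
  defines "S \<equiv> sllr f g 0 ys + (if y then llr else - llr)"
  shows "valid_state (stp (At (0, i) ys) y)"
    and "state_value (stp (At (0, i) ys) y) \<le> ennreal (leaf_value i S)"
proof -
  from valid have tree: "(0, i) \<in> tree_nodes k"
    and range: "0 \<le> sllr f g 0 ys" "sllr f g 0 ys \<le> thr"
    by auto
  have S: "sllr f g 0 (ys @ [y]) = S"
    by (simp add: S_def sllr0 algebra_simps)
  \<comment> \<open>The score is an integer that moves by 1, so a leaf is left exactly at score -1;
    the boundary value at \<open>- llr\<close> is therefore enough.\<close>
  have exit: "S = - llr" if "S < 0"
  proof -
    have "score ys \<ge> 0" "score (ys @ [y]) < 0"
      using range(1) that llr_pos unfolding S[symmetric] sllr0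
      by (simp_all add: zero_le_mult_iff mult_less_0_iff)
    then have "score (ys @ [y]) = - 1"
      by (simp split: if_splits)
    then show ?thesis
      unfolding S[symmetric] sllr0 by simp
  qed
  have parent: "parent k (0, i) = (1, i div 2)"
    using k by (simp add: parent_def)
  have ptree: "(1, i div 2) \<in> tree_nodes k"
    using parent_in_tree_nodes[OF tree] by (simp add: parent)
  have st: "stp (At (0, i) ys) y =
    (if S > thr then Declared i else if S < 0 then At (1, i div 2) [] else At (0, i) (ys @ [y]))"
    using S by (simp add: Let_def parent thr_def)
  show "valid_state (stp (At (0, i) ys) y)"
    unfolding st using tree valid_state_At_Nil[OF ptree] S by simp
  consider "S > thr" | "S < 0" "S \<le> thr" | "0 \<le> S" "S \<le> thr"
    by linarith
  then show "state_value (stp (At (0, i) ys) y) \<le> ennreal (leaf_value i S)"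
  proof cases
    case 1
    then show ?thesis
      unfolding st using leaf_value_wrong[of i S] by (auto simp: of_bool_def)
  next
    case 2
    have "state_value (At (1, i div 2) []) \<le> ennreal (node_value 1 (i div 2))"
      by (rule state_value_At_Nil_le[OF ptree])
    also have "\<dots> \<le> ennreal (leaf_value i S)"
      using leaf_value_exit exit[OF 2(1)] by (simp add: ennreal_leI)
    finally show ?thesis
      unfolding st using 2 by simp
  next
    case 3
    then show ?thesis
      unfolding st using S by simp
  qed
qed

lemma state_value_super:
  assumes valid: "valid_state (At v ys)"
  shows "ennreal c + (\<integral>\<^sup>+ y. state_value (stp (At v ys) y)
      \<partial>obs_law f g m (irw_probe K (At v ys))) \<le> state_value (At v ys)"
proof (cases v)
  case (Pair l i)
  show ?thesis
  proof (cases "l = 0")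
    case False
    then have l: "l > 0" by simp
    have valid': "valid_state (At (l, i) ys)"
      using valid Pair by simp
    have len: "length ys < 2 * K l"
      using valid' l by simp
    have "ennreal c + (\<integral>\<^sup>+ y. state_value (stp (At v ys) y)
        \<partial>obs_law f g m (irw_probe K (At v ys)))
      \<le> ennreal c + (\<integral>\<^sup>+ y. visit_value k f g K tie c m (\<lambda>(l, i). ennreal (node_value l i))
          l i (ys @ [y]) \<partial>obs_law f g m (irw_probe K (At v ys)))"
      unfolding Pair by (intro add_left_mono nn_integral_mono internal_step(2) valid' l)
    also have "\<dots> = state_value (At v ys)"
      using l unfolding Pair visit_value_step[where K = K, OF len l] by simp
    finally show ?thesis .
  next
    case True
    then have valid': "valid_state (At (0, i) ys)"
      using valid Pair by simp
    define S where "S = sllr f g 0 ys"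
    have S: "0 \<le> S" "S \<le> thr"
      using valid' by (simp_all add: S_def)
    define r where "r = (if i = m then 1 - q else q)"
    have r: "0 \<le> r" "r \<le> 1" using q by (simp_all add: r_def)
    have law: "obs_law f g m (irw_probe K (At v ys)) = bernoulli_pmf r"
      using True Pair f0 g0 by (auto simp: obs_law_def subtree_contains_def r_def)
    \<comment> \<open>Nonnegativity keeps \<open>ennreal\<close> from truncating; one step leads
      from \<open>[0, thr]\<close> at most \<open>llr\<close> beyond either end.\<close>
    have nonneg: "leaf_value i (S + llr) \<ge> 0" "leaf_value i (S - llr) \<ge> 0"
      using S llr_pos by (auto intro!: leaf_value_nonneg)
    have "(\<integral>\<^sup>+ y. state_value (stp (At v ys) y) \<partial>bernoulli_pmf r)
      \<le> (\<integral>\<^sup>+ y. ennreal (leaf_value i (S + (if y then llr else - llr))) \<partial>bernoulli_pmf r)"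
      using True Pair leaf_step(2)[OF valid'] by (intro nn_integral_mono) (simp add: S_def)
    also have "\<dots> = ennreal (r * leaf_value i (S + llr) + (1 - r) * leaf_value i (S - llr))"
      using r nonneg
      by (simp add: ennreal_mult[symmetric] ennreal_plus[symmetric] mult.commute del: ennreal_plus)
    finally have "ennreal c + (\<integral>\<^sup>+ y. state_value (stp (At v ys) y)
        \<partial>obs_law f g m (irw_probe K (At v ys)))
      \<le> ennreal c + ennreal (r * leaf_value i (S + llr) + (1 - r) * leaf_value i (S - llr))"
      unfolding law by (intro add_left_mono)
    also have "\<dots> = ennreal (c + (r * leaf_value i (S + llr) + (1 - r) * leaf_value i (S - llr)))"
      using c r nonneg by (simp add: ennreal_plus[symmetric] del: ennreal_plus)
    also have "\<dots> = ennreal (leaf_value i S)"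
      using leaf_value_super[of i S] by (simp add: r_def split: if_splits)
    also have "\<dots> = state_value (At v ys)"
      using True Pair by (simp add: S_def)
    finally show ?thesis .
  qed
qed

lemma hypothesis_risk_le:
  "(\<integral>\<^sup>+ \<omega>. (of_bool (\<not> declares (irw k f g K tie c) m \<omega>) +
      ennreal c * ennreal_of_enat (stop_time (irw k f g K tie c) \<omega>)) \<partial>hyp_measure k f g m)
    \<le> ennreal (base + c * a * k)"
proof -
  have root: "(k, 0) \<in> tree_nodes k"
    by (simp add: tree_nodes_def)
  have "(\<integral>\<^sup>+ \<omega>. (of_bool (\<not> declares (irw k f g K tie c) m \<omega>) +
      ennreal c * ennreal_of_enat (stop_time (irw k f g K tie c) \<omega>)) \<partial>hyp_measure k f g m)
    \<le> state_value (At (k, 0) [])"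
  proof (rule irw_expected_loss_le[where I = "Collect valid_state"])
    show "At (k, 0) [] \<in> Collect valid_state"
      using valid_state_At_Nil[OF root] by (rule CollectI)
  next
    fix v and ys :: "bool list" assume "At v ys \<in> Collect valid_state"
    then have valid: "valid_state (At v ys)" by simp
    obtain l i where v: "v = (l, i)" by (cases v)
    show "irw_probe K (At v ys) \<in> tree_nodes k"
      using valid children_in_tree_nodes[of l i k] by (auto simp: v)
    show "stp (At v ys) y \<in> Collect valid_state" for y
      using valid internal_step(1)[of l i ys y] leaf_step(1)[of i ys y]
      unfolding v by (cases "l = 0") (simp_all del: irw_step.simps)
    show "ennreal c + (\<integral>\<^sup>+ y. state_value (stp (At v ys) y)
        \<partial>obs_law f g m (irw_probe K (At v ys))) \<le> state_value (At v ys)"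
      by (rule state_value_super[OF valid])
  qed (use c in auto)
  also have "\<dots> \<le> ennreal (node_value k 0)"
    by (rule state_value_At_Nil_le[OF root])
  also have "node_value k 0 = base + c * a * k"
    using m by (simp add: node_value_def target_dist_on)
  finally show ?thesis .
qed

end

subsection \<open>The risk bound\<close>

text \<open>Minimality reduces the bound to exhibiting one adequate size of the order of the inverse
  squared bias.\<close>

lemma least_size_bernoulli_le:
  fixes \<alpha> :: nat and \<mu>\<^sub>0 p :: real and \<mu> :: "nat \<Rightarrow> real" and f g :: "nat \<Rightarrow> bool pmf"
  assumes \<mu>0: "0 < \<mu>\<^sub>0" "\<mu>\<^sub>0 < 1 / 2" and p: "1 / 2 < p" "p < 1"
    and \<mu>: "\<And>l. \<mu> l = 1 / 2 - (1 / 2 - \<mu>\<^sub>0) * (real l + 1) powi (- int \<alpha>)"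
    and f: "\<And>l. f l = bernoulli_pmf (\<mu> l)" and g: "\<And>l. g l = bernoulli_pmf (1 - \<mu> l)"
    and l: "l \<ge> 1"
  shows "adequate_size p f g l (least_size p f g l)"
    and "real (least_size p f g l)
      \<le> (ln (2 / (1 - p)) / (1 / 2 - \<mu>\<^sub>0)\<^sup>2 + 1) * real l ^ (2 * \<alpha>)"
proof -
  define G where "G = ln (2 / (1 - p))"
  define d where "d = 1 / 2 - \<mu> (l - 1)"
  \<comment> \<open>With \<open>n * d\<^sup>2\<close> at least \<open>ln (2 / (1 - p))\<close>, the
    Hoeffding term is at most \<open>((1 - p) / 2)\<^sup>2\<close>, more than adequacy
    requires.\<close>
  define n where "n = nat \<lceil>G / d\<^sup>2\<rceil>"
  have G: "G > 0"
    using p by (simp add: G_def)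
  \<comment> \<open>A visit at level l samples children of level l - 1, so the base
    \<open>(l - 1) + 1\<close> of the power is l itself.\<close>
  have d_eq: "d = (1 / 2 - \<mu>\<^sub>0) / real l ^ \<alpha>"
    using l by (simp add: d_def \<mu> of_nat_diff power_int_minus field_simps)
  have lpow: "1 \<le> real l ^ j" for j
    using l by simp
  have d: "0 < d" "d \<le> 1 / 2 - \<mu>\<^sub>0"
    using \<mu>0 l lpow[of \<alpha>] by (simp_all add: d_eq divide_le_eq mult_left_le)
  have n_pos: "n > 0"
    using G d by (simp add: n_def)
  have "G / d\<^sup>2 \<le> n"
    by (simp add: n_def real_nat_ceiling_ge)
  then have "G \<le> n * d\<^sup>2"
    using d by (simp add: pos_divide_le_eq)
  then have "exp (- 2 * real n * d\<^sup>2) \<le> exp (- (2 * G))"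
    by simp
  also have "\<dots> = ((1 - p) / 2)\<^sup>2"
    using p by (simp add: exp_minus exp_double G_def power_divide)
  finally have "2 * exp (- 2 * real n * d\<^sup>2) \<le> (1 - p) * ((1 - p) / 2)"
    by (simp add: power2_eq_square)
  also have "\<dots> < (1 - p) * 1"
    using p by (intro mult_strict_left_mono) auto
  finally have "2 * exp (- 2 * real n * d\<^sup>2) < 1 - p"
    by simp
  then have adequate: "adequate_size p f g l n"
    using d \<mu>0 n_pos f[of "l - 1"] g[of "l - 1"] unfolding d_def
    by (intro adequate_size_bernoulli[where q = "\<mu> (l - 1)"]) auto
  show "adequate_size p f g l (least_size p f g l)"
    unfolding least_size_def by (rule LeastI[of "adequate_size p f g l", OF adequate])
  have "least_size p f g l \<le> n"
    unfolding least_size_def by (rule Least_le[of "adequate_size p f g l", OF adequate])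
  also have "real n \<le> G / d\<^sup>2 + 1"
    using G d by (simp add: n_def)
  also have "\<dots> = G / (1 / 2 - \<mu>\<^sub>0)\<^sup>2 * real l ^ (2 * \<alpha>) + 1"
    by (simp add: d_eq power_divide power_mult[symmetric] mult.commute)
  also have "\<dots> \<le> (G / (1 / 2 - \<mu>\<^sub>0)\<^sup>2 + 1) * real l ^ (2 * \<alpha>)"
    using lpow[of "2 * \<alpha>"] by (simp add: distrib_right)
  finally show "real (least_size p f g l) \<le> (ln (2 / (1 - p)) / (1 / 2 - \<mu>\<^sub>0)\<^sup>2 + 1) * real l ^ (2 * \<alpha>)"
    by (simp add: G_def)
qed

lemma bayes_risk_le_hypothesis_risk:
  fixes f g :: "nat \<Rightarrow> 'o::countable pmf"
  assumes prior: "is_prior k \<pi>"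
    and risk: "\<And>m. m < 2 ^ k \<Longrightarrow>
      (\<integral>\<^sup>+ \<omega>. (of_bool (\<not> declares \<Gamma> m \<omega>) + ennreal c * ennreal_of_enat (stop_time \<Gamma> \<omega>))
        \<partial>hyp_measure k f g m) \<le> R"
  shows "bayes_risk k f g \<pi> c \<Gamma> \<le> R"
proof -
  have "bayes_risk k f g \<pi> c \<Gamma> \<le> (\<Sum>m<2 ^ k. ennreal (\<pi> m) * R)"
    unfolding bayes_risk_eq by (intro sum_mono mult_left_mono risk) auto
  also have "\<dots> = (\<Sum>m<2 ^ k. ennreal (\<pi> m)) * R"
    by (rule sum_distrib_right[symmetric])
  also have "(\<Sum>m<2 ^ k. ennreal (\<pi> m)) = ennreal (\<Sum>m<2 ^ k. \<pi> m)"
    using prior by (intro sum_ennreal) (simp add: is_prior_def)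
  finally show ?thesis
    using prior by (simp add: is_prior_def)
qed

text \<open>The first conjunct certifies that \<open>least_size\<close> is a genuine minimum and not
  the arbitrary \<open>LEAST\<close> of an empty set. The constants are fixed before the tree depth,
  the cost, the prior, the sample sizes and the tie rule.\<close>

theorem theorem2:
  fixes \<alpha> B :: nat and \<mu>\<^sub>0 p :: real and \<mu> :: "nat \<Rightarrow> real"
    and f g :: "nat \<Rightarrow> bool pmf"
  assumes "\<alpha> > 0" and "0 < \<mu>\<^sub>0" and "\<mu>\<^sub>0 < 1 / 2" and "1 / 2 < p" and "p < 1"
    and "\<And>l. \<mu> l = 1 / 2 - (1 / 2 - \<mu>\<^sub>0) * (real l + 1) powi (- int \<alpha>)"
    and "\<And>l. f l = bernoulli_pmf (\<mu> l)"
    and "\<And>l. g l = bernoulli_pmf (1 - \<mu> l)"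
  shows "(\<forall>l\<ge>1. adequate_size p f g l (least_size p f g l)) \<and>
    (\<exists>C\<^sub>1 C\<^sub>2 :: real. \<forall>(k::nat) (c::real) (\<pi> :: nat \<Rightarrow> real) (K :: nat \<Rightarrow> nat)
        (tie :: node \<Rightarrow> bool list \<Rightarrow> bool).
      k \<ge> 1 \<longrightarrow> 0 < c \<longrightarrow> c < 1 \<longrightarrow> is_prior k \<pi> \<longrightarrow>
      (\<forall>l\<in>{1..k}. adequate_size p f g l (K l) \<and> K l \<le> B * least_size p f g l) \<longrightarrow>
      bayes_risk k f g \<pi> c (irw k f g K tie c)
        \<le> ennreal (C\<^sub>1 * (c * real k ^ (2 * \<alpha> + 1))
                   + c * ln (real k / c) / KL_pmf (g 0) (f 0)
                   + C\<^sub>2 * c))"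
proof -
  note least = least_size_bernoulli_le[where \<alpha> = \<alpha> and \<mu>\<^sub>0 = \<mu>\<^sub>0 and p = p and \<mu> = \<mu> and f = f and g = g,
      OF assms(2-8)]
  define Q where "Q = ln (2 / (1 - p)) / (1 / 2 - \<mu>\<^sub>0)\<^sup>2 + 1"
  \<comment> \<open>The sum of the slope demanded by internal visits, up to the power of k, and the
    slope demanded by leaf visits.\<close>
  define A where "A = 2 * (real B * Q) / (2 * p - 1) + (1 / (1 - 2 * \<mu>\<^sub>0) + 1)"
  have Q: "Q \<ge> 0"
    using assms by (simp add: Q_def)
  have A: "2 * (real B * Q) \<le> A * (2 * p - 1)" "1 / (1 - 2 * \<mu>\<^sub>0) + 1 \<le> A" "A \<ge> 0"
  proof -
    have "0 \<le> (1 / (1 - 2 * \<mu>\<^sub>0) + 1) * (2 * p - 1)"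
      using assms by (intro mult_nonneg_nonneg) auto
    then show "2 * (real B * Q) \<le> A * (2 * p - 1)"
      using assms by (simp add: A_def distrib_right)
    show "1 / (1 - 2 * \<mu>\<^sub>0) + 1 \<le> A" "A \<ge> 0"
      using assms Q by (simp_all add: A_def)
  qed
  have \<mu>0: "\<mu> 0 = \<mu>\<^sub>0"
    using assms(6)[of 0] by simp
  have "bayes_risk k f g \<pi> c (irw k f g K tie c)
      \<le> ennreal (A * (1 + \<mu>\<^sub>0 / (1 - 2 * \<mu>\<^sub>0)) * (c * real k ^ (2 * \<alpha> + 1))
          + c * ln (real k / c) / KL_pmf (g 0) (f 0) + 1 / (1 - 2 * \<mu>\<^sub>0) * c)"
    if k: "k \<ge> 1" and c: "0 < c" "c < 1" and prior: "is_prior k \<pi>"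
      and K: "\<forall>l\<in>{1..k}. adequate_size p f g l (K l) \<and> K l \<le> B * least_size p f g l"
    for k c \<pi> K tie
  proof (rule bayes_risk_le_hypothesis_risk[OF prior])
    fix m :: nat assume m: "m < 2 ^ k"
    \<comment> \<open>One slope must serve all levels, so the sample bound is taken at the top level
      k.\<close>
    define a where "a = A * real k ^ (2 * \<alpha>)"
    have kpow: "1 \<le> real k ^ (2 * \<alpha>)"
      using k by simp
    have drift: "2 * real (K l) \<le> a * (2 * p - 1)" if l: "l \<in> {1..k}" for l
    proof -
      have "real (K l) \<le> real B * real (least_size p f g l)"
        using K l by (metis of_nat_le_iff of_nat_mult)
      also have "\<dots> \<le> real B * (Q * real l ^ (2 * \<alpha>))"
        using least(2)[of l] l by (intro mult_left_mono) (auto simp: Q_def)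
      also have "\<dots> \<le> real B * (Q * real k ^ (2 * \<alpha>))"
        using l Q by (intro mult_left_mono power_mono) auto
      finally have "2 * real (K l) \<le> 2 * (real B * Q) * real k ^ (2 * \<alpha>)"
        by simp
      also have "\<dots> \<le> A * (2 * p - 1) * real k ^ (2 * \<alpha>)"
        using A by (intro mult_right_mono) auto
      finally show ?thesis by (simp add: a_def mult_ac)
    qed
    have "A * 1 \<le> a"
      unfolding a_def using A kpow by (intro mult_left_mono) auto
    then interpret bernoulli_leaf_irw k m f g K tie c p \<mu>\<^sub>0 a
      using k m c assms K drift A \<mu>0 by unfold_locales auto
    have kl_eq: "KL_pmf (g 0) (f 0) = kl"
      using assms \<mu>0 by (simp add: KL_pmf_bernoulli kl_def llr_def)
    \<comment> \<open>The overshoot allowance is the source of the O(c) term.\<close>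
    have "c * llr / kl = 1 / (1 - 2 * \<mu>\<^sub>0) * c"
      using llr_pos by (simp add: kl_def)
    then have "c * (thr + llr) / kl = c * thr / kl + 1 / (1 - 2 * \<mu>\<^sub>0) * c"
      by (simp add: add_divide_distrib distrib_left)
    \<comment> \<open>The return cost at the target lacks a factor k; inflating it by k lets it join
      the root term \<open>c * a * k\<close>.\<close>
    moreover have "c * a * \<mu>\<^sub>0 / (1 - 2 * \<mu>\<^sub>0) \<le> c * a * \<mu>\<^sub>0 / (1 - 2 * \<mu>\<^sub>0) * k"
    proof -
      have "c * a * \<mu>\<^sub>0 / (1 - 2 * \<mu>\<^sub>0) * 1 \<le> c * a * \<mu>\<^sub>0 / (1 - 2 * \<mu>\<^sub>0) * k"
        using k c q a_pos by (intro mult_left_mono) auto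
      then show ?thesis by simp
    qed
    moreover have "c * a * \<mu>\<^sub>0 / (1 - 2 * \<mu>\<^sub>0) * k + c * a * k
        = A * (1 + \<mu>\<^sub>0 / (1 - 2 * \<mu>\<^sub>0)) * (c * real k ^ (2 * \<alpha> + 1))"
      by (simp add: a_def algebra_simps)
    ultimately have "base + c * a * k \<le> A * (1 + \<mu>\<^sub>0 / (1 - 2 * \<mu>\<^sub>0)) * (c * real k ^ (2 * \<alpha> + 1))
        + c * ln (real k / c) / KL_pmf (g 0) (f 0) + 1 / (1 - 2 * \<mu>\<^sub>0) * c"
      unfolding base_def kl_eq thr_def by linarith
    then show "(\<integral>\<^sup>+ \<omega>. (of_bool (\<not> declares (irw k f g K tie c) m \<omega>) +
        ennreal c * ennreal_of_enat (stop_time (irw k f g K tie c) \<omega>)) \<partial>hyp_measure k f g m)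
      \<le> ennreal (A * (1 + \<mu>\<^sub>0 / (1 - 2 * \<mu>\<^sub>0)) * (c * real k ^ (2 * \<alpha> + 1))
        + c * ln (real k / c) / KL_pmf (g 0) (f 0) + 1 / (1 - 2 * \<mu>\<^sub>0) * c)"
      using hypothesis_risk_le by (rule order_trans[OF _ ennreal_leI, rotated])
  qed
  with least(1) show ?thesis by blast
qed

end
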